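(* Let $d\ge1$ be an integer and let $$\lambda=\frac{d+2+\sqrt{d(d+4)}}{2}.$$ Let $\alpha$ be defined by any one of the constructions (E), (P1), (P2) described in the context, where the sequence $(u_n)_{n\ge1}$ of positive integers is specified by $$u_n=\sum_{j=0}^{d-1}v_n^{(j)}\,x_n^{d-1-j},\qquad n\ge1,$$ where for each $j\in\{0,\dots,d-1\}$ the sequence $(v_n^{(j)})_{n\ge1}$ is an integer sequence, $v_n^{(0)}\in\mathbb Z_{>0}$ for all $n\ge1$, and, for some real $\nu$ with $0<\nu<\lambda$, as $n\to\infty$, $$\log v_n^{(0)}=O(\nu^n)\qquad\text{and}\qquad v_n^{(j)}=O(v_n^{(0)})\quad\text{for } j=1,\dots,d-1.$$ Then $\alpha$ has irrationality exponent $\mu(\alpha)=\lambda$.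
   Context: The irrationality exponent $\mu(\alpha)$ of a real number $\alpha$ is the supremum of the set of real $\mu$ such that $0<|\alpha-P/Q|<1/Q^\mu$ holds for infinitely many rational numbers $P/Q$. Continued fractions: $[a_0;a_1,\dots,a_n]$ denotes the finite continued fraction with $a_0\in\mathbb Z$ and $a_j\in\mathbb Z_{>0}$ for $j\ge1$. The denominators $q_n$ of its convergents satisfy $q_{n+1}=a_{n+1}q_n+q_{n-1}$ for $n\ge-1$, with $q_{-1}=0$, $q_{-2}=1$. Every rational number has such an expansion with last index even, and one with last index odd. Common data: a rational $p/q$ in lowest terms with $q\ge1$, an integer $m\ge0$, and a sequence $(u_n)_{n\ge1}$ of positive integers ($u_n$ is allowed to depend on $x_n$). Given a positive integer $y_0$, the sequences $(y_n)_{n\ge0}$ and $(x_n)_{n\ge1}$ are defined by $x_1=q$, $y_j=y_{j-1}(1+u_jx_j)$, $x_{j+1}=x_jy_j$ for $j\ge1$. (E) Write $p/q=[a_0;a_1,\dots,a_{2k}]$ (last index even), put $y_0=mq+q_{2k-1}+1$, and let $\alpha=\frac pq+\sum_{j\ge2}\frac1{x_j}$. (P1) Assume $q>1$, write $p/q=[a_0;a_1,\dots,a_{2k}]$ (last index even), put $y_0=mq+q_{2k-1}-1$, requiring $m\ge1$ if $q_{2k-1}=1$, and let $\alpha=\frac pq+\sum_{j\ge2}\frac{(-1)^j}{x_j}$. (P2) Assume $q>1$, write $p/q=[a_0;a_1,\dots,a_{2k+1}]$ (last index odd), put $y_0=mq+q_{2k}-1$, requiring $m\ge1$ if $q_{2k}=1$,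 and let $\alpha=\frac pq-\sum_{j\ge2}\frac{(-1)^j}{x_j}$. *)

theory Defs
  imports Complex_Main "HOL-Library.Extended_Real" "HOL-Library.Landau_Symbols"
begin

text \<open>
  Each rational number is represented by its reduced fraction with positive denominator.
  The supremum is taken in the extended reals, so it may be infinite.
\<close>

definition irrationality_exponent :: "real \<Rightarrow> ereal" where
  "irrationality_exponent \<alpha> =
     Sup {ereal \<mu> | \<mu> :: real.
       infinite {r :: rat.
         0 < \<bar>\<alpha> - of_rat r\<bar> \<and>
         \<bar>\<alpha> - of_rat r\<bar> < 1 / real_of_int (snd (quotient_of r)) powr \<mu>}}"

text \<open>
  The continued fraction \<open>[a\<^sub>0; a\<^sub>1, \<dots>, a\<^sub>n]\<close> is represented by the list of its \<open>n + 1\<close>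
  partial quotients; in particular the last index is even iff the length is odd.
\<close>

fun cf_value :: "int list \<Rightarrow> real" where
  "cf_value [] = 0"
| "cf_value [a] = of_int a"
| "cf_value (a # b # as) = of_int a + 1 / cf_value (b # as)"

definition is_cf_expansion :: "int list \<Rightarrow> real \<Rightarrow> bool" where
  "is_cf_expansion as r \<longleftrightarrow>
     as \<noteq> [] \<and> (\<forall>j. 1 \<le> j \<and> j < length as \<longrightarrow> as ! j > 0) \<and> cf_value as = r"

text \<open>
  \<open>cf_denom_shift as i\<close> is the convergent denominator with index \<open>i - 2\<close>, so that the
  recurrence starts from the values at the indices \<open>-2\<close> and \<open>-1\<close>; \<open>cf_denom\<close> has the usual indexing.
  The value is meaningful only for indices from \<open>-2\<close> up to the last index of the expansion.
\<close>

fun cf_denom_shift :: "int list \<Rightarrow> nat \<Rightarrow> int" where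
  "cf_denom_shift as 0 = 1"
| "cf_denom_shift as (Suc 0) = 0"
| "cf_denom_shift as (Suc (Suc n)) = as ! n * cf_denom_shift as (Suc n) + cf_denom_shift as n"

definition cf_denom :: "int list \<Rightarrow> int \<Rightarrow> int" where
  "cf_denom as i = cf_denom_shift as (nat (i + 2))"

text \<open>
  The sequences \<open>u\<close> and \<open>x\<close> are indexed from 1; their values at 0 are irrelevant.
  The recursion is a relation between sequences because \<open>u j\<close> may depend on \<open>x j\<close>.
\<close>

definition xy_recursion ::
    "int \<Rightarrow> int \<Rightarrow> (nat \<Rightarrow> int) \<Rightarrow> (nat \<Rightarrow> int) \<Rightarrow> (nat \<Rightarrow> int) \<Rightarrow> bool" where
  "xy_recursion q y0 u x y \<longleftrightarrow>
     y 0 = y0 \<and> x 1 = q \<and>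
     (\<forall>j\<ge>1. y j = y (j - 1) * (1 + u j * x j) \<and> x (j + 1) = x j * y j)"

definition construction_E ::
    "int \<Rightarrow> int \<Rightarrow> int \<Rightarrow> (nat \<Rightarrow> int) \<Rightarrow> (nat \<Rightarrow> int) \<Rightarrow> (nat \<Rightarrow> int) \<Rightarrow> real \<Rightarrow> bool" where
  "construction_E p q m u x y \<alpha> \<longleftrightarrow>
     (\<exists>as k. length as = 2 * k + 1 \<and>
        is_cf_expansion as (of_int p / of_int q) \<and>
        xy_recursion q (m * q + cf_denom as (2 * int k - 1) + 1) u x y) \<and>
     \<alpha> = of_int p / of_int q + (\<Sum>j. 1 / of_int (x (j + 2)))"

definition construction_P1 ::
    "int \<Rightarrow> int \<Rightarrow> int \<Rightarrow> (nat \<Rightarrow> int) \<Rightarrow> (nat \<Rightarrow> int) \<Rightarrow> (nat \<Rightarrow> int) \<Rightarrow> real \<Rightarrow> bool" where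
  "construction_P1 p q m u x y \<alpha> \<longleftrightarrow>
     q > 1 \<and>
     (\<exists>as k. length as = 2 * k + 1 \<and>
        is_cf_expansion as (of_int p / of_int q) \<and>
        (cf_denom as (2 * int k - 1) = 1 \<longrightarrow> m \<ge> 1) \<and>
        xy_recursion q (m * q + cf_denom as (2 * int k - 1) - 1) u x y) \<and>
     \<alpha> = of_int p / of_int q + (\<Sum>j. (-1) ^ (j + 2) / of_int (x (j + 2)))"

definition construction_P2 ::
    "int \<Rightarrow> int \<Rightarrow> int \<Rightarrow> (nat \<Rightarrow> int) \<Rightarrow> (nat \<Rightarrow> int) \<Rightarrow> (nat \<Rightarrow> int) \<Rightarrow> real \<Rightarrow> bool" where
  "construction_P2 p q m u x y \<alpha> \<longleftrightarrow>
     q > 1 \<and>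
     (\<exists>as k. length as = 2 * k + 2 \<and>
        is_cf_expansion as (of_int p / of_int q) \<and>
        (cf_denom as (2 * int k) = 1 \<longrightarrow> m \<ge> 1) \<and>
        xy_recursion q (m * q + cf_denom as (2 * int k) - 1) u x y) \<and>
     \<alpha> = of_int p / of_int q - (\<Sum>j. (-1) ^ (j + 2) / of_int (x (j + 2)))"

end

theory Submission
  imports Defs
begin

text \<open>
  All three constructions have the form \<open>\<alpha> = p / q + t \<Sum>\<^sub>j s\<^sup>j / x\<^sub>j\<close> with signs \<open>s\<close>, \<open>t\<close>. The
  convergents of \<open>\<alpha>\<close> beyond \<open>p / q\<close> have the denominators \<open>x\<^sub>1, y\<^sub>1 - s, x\<^sub>2, y\<^sub>2 - s, \<dots>\<close>, because
  \<open>y\<^sub>n - s = u\<^sub>n y\<^sub>n\<^sub>-\<^sub>1 x\<^sub>n + (y\<^sub>n\<^sub>-\<^sub>1 - s)\<close> and \<open>x\<^sub>n\<^sub>+\<^sub>1 = x\<^sub>n (y\<^sub>n - s) + s x\<^sub>n\<close>. Hence the irrationality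
  exponent is \<open>1\<close> plus the limit superior of the ratio of the logarithms of consecutive denominators.
  By the choice of \<open>u\<^sub>n\<close>, \<open>X\<^sub>n = ln x\<^sub>n\<close> satisfies \<open>X\<^sub>n\<^sub>+\<^sub>2 = (d + 2) X\<^sub>n\<^sub>+\<^sub>1 - X\<^sub>n + O(\<nu>\<^sup>n)\<close> (after
  enlarging \<open>\<nu>\<close> so that \<open>1 < \<nu> < \<lambda>\<close>), whose characteristic
  roots are \<open>\<lambda>\<close> and \<open>1 / \<lambda>\<close>, so \<open>X\<^sub>n\<^sub>+\<^sub>1 / X\<^sub>n\<close> tends to \<open>\<lambda>\<close>. The two kinds of ratios then tend to \<open>\<lambda> - 1\<close>
  and \<open>\<lambda> / (\<lambda> - 1)\<close>, and the first is at least as large.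
\<close>

section \<open>Convergents of finite continued fractions\<close>

lemma reduced_fraction_unique:
  fixes a b c d :: int
  assumes "coprime a b" "coprime c d" "b > 0" "d > 0" "a * d = c * b"
  shows "a = c \<and> b = d"
proof -
  have "b dvd d * a" "d dvd b * c" using assms(5) by (metis dvd_triv_right mult.commute)+
  then have "b dvd d" "d dvd b"
    using assms by (auto simp: coprime_dvd_mult_left_iff coprime_commute)
  then have "b = d" using assms zdvd_antisym_nonneg[of b d] by simp
  then show ?thesis using assms by simp
qed

text \<open>Convergent numerators with the same index shift by 2 as in
  \<open>cf_denom_shift\<close>: the recurrence starts at the indices -2 and -1.\<close>

fun cf_num_shift :: "int list \<Rightarrow> nat \<Rightarrow> int" where
  "cf_num_shift as 0 = 0"
| "cf_num_shift as (Suc 0) = 1"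
| "cf_num_shift as (Suc (Suc n)) = as ! n * cf_num_shift as (Suc n) + cf_num_shift as n"

lemma cf_shift_determinant:
  "cf_num_shift as (Suc n) * cf_denom_shift as n - cf_num_shift as n * cf_denom_shift as (Suc n) = (-1) ^ n"
  by (induction n) (auto simp: algebra_simps)

text \<open>Prepending \<open>a\<close> turns the value N/D of the remaining fraction into a + D/N =
  (a N + D)/N, so numerators of the tail become denominators of the whole.\<close>

lemma cf_shift_Cons:
  "cf_denom_shift (a # as) (Suc n) = cf_num_shift as n \<and>
   cf_num_shift (a # as) (Suc n) = a * cf_num_shift as n + cf_denom_shift as n"
proof (induction n rule: induct_nat_012)
  case (ge2 n)
  then show ?case by (simp add: algebra_simps)
qed auto

text \<open>Meant for the tail of an expansion, where every partial quotient is positive. Through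
  \<open>cf_shift_Cons\<close> the strict positivity of its numerators becomes that of the
  denominators of the full expansion.\<close>

lemma cf_shift_nonneg:
  assumes "\<forall>a\<in>set as. a > 0"
  shows "n \<le> length as \<Longrightarrow>
    cf_num_shift as n \<ge> 0 \<and> cf_num_shift as (Suc n) > 0 \<and>
    cf_denom_shift as n \<ge> 0 \<and> cf_denom_shift as (Suc n) \<ge> 0"
proof (induction n)
  case (Suc n)
  then have "as ! n > 0" using assms by simp
  with Suc show ?case by (auto intro!: add_pos_nonneg add_nonneg_nonneg)
qed auto

lemma cf_denom_shift_pos:
  assumes "\<forall>j. 1 \<le> j \<and> j < length as \<longrightarrow> as ! j > 0" and "2 \<le> n" "n \<le> length as + 1"
  shows "cf_denom_shift as n > 0"
proof (cases as)
  case (Cons a bs)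
  have "\<forall>b\<in>set bs. b > 0"
    using assms(1) Cons by (force simp: in_set_conv_nth)
  moreover obtain k where "n = Suc (Suc k)" using assms(2) by (metis Suc_le_D numeral_2_eq_2 Suc_le_mono)
  ultimately show ?thesis using cf_shift_nonneg[of bs k] assms Cons cf_shift_Cons[of a bs "Suc k"] by auto
qed (use assms in auto)

lemma cf_value_eq:
  assumes "as \<noteq> []" "\<forall>a\<in>set (tl as). a > 0"
  shows "cf_value as = real_of_int (cf_num_shift as (length as + 1)) / real_of_int (cf_denom_shift as (length as + 1))"
  using assms
proof (induction as rule: cf_value.induct)
  case (3 a b as)
  have pos: "\<forall>c\<in>set (b # as). c > 0" using 3 by simp
  have N: "cf_num_shift (b # as) (length (b # as) + 1) > 0"
    using cf_shift_nonneg[OF pos order_refl] by simp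
  show ?case
    using 3 N cf_shift_Cons[of a "b # as" "length (b # as) + 1"]
    by (simp add: field_simps del: cf_num_shift.simps cf_denom_shift.simps)
qed auto

text \<open>The determinant identity shows that the last convergent is reduced, so its numerator and
  denominator are \<open>p\<close> and \<open>q\<close>; the same identity then relates them to the
  penultimate convergent. In the boundary case of length 1 the penultimate denominator is 0.\<close>

lemma cf_expansion_penultimate:
  assumes cf: "is_cf_expansion as (of_int p / of_int q)" and pq: "q \<ge> 1" "coprime p q"
  shows "\<exists>r. p * cf_denom_shift as (length as) - r * q = (-1) ^ length as"
    and "cf_denom_shift as (length as) \<ge> 0"
    and "length as \<ge> 2 \<longrightarrow> cf_denom_shift as (length as) \<ge> 1"
    and "length as = 1 \<longrightarrow> q = 1"
proof -
  let ?L = "length as"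
  let ?N = "cf_num_shift as (?L + 1)" and ?D = "cf_denom_shift as (?L + 1)"
  have ne: "as \<noteq> []" and pos: "\<forall>j. 1 \<le> j \<and> j < ?L \<longrightarrow> as ! j > 0"
    and val: "cf_value as = of_int p / of_int q"
    using cf by (auto simp: is_cf_expansion_def)
  have L: "?L \<ge> 1" using ne by (cases as) auto
  have D: "?D > 0" using cf_denom_shift_pos[OF pos, of "?L + 1"] L by simp
  have "\<forall>a\<in>set (tl as). a > 0"
    using pos by (auto simp: in_set_conv_nth nth_tl)
  then have eq: "real_of_int p / of_int q = of_int ?N / of_int ?D"
    using cf_value_eq[OF ne] val by simp
  have det: "?N * cf_denom_shift as ?L - cf_num_shift as ?L * ?D = (-1) ^ ?L"
    using cf_shift_determinant[of as ?L] by simp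
  have "coprime ?N ?D"
  proof (rule coprimeI)
    fix c assume "c dvd ?N" "c dvd ?D"
    then have "c dvd (-1) ^ ?L" unfolding det[symmetric] by (simp del: cf_num_shift.simps cf_denom_shift.simps)
    then show "is_unit c" by (rule dvd_trans) (cases "even ?L"; simp)
  qed
  moreover have "real_of_int (p * ?D) = of_int (?N * q)"
    using eq D pq by (simp add: field_simps del: cf_num_shift.simps cf_denom_shift.simps)
  then have "p * ?D = ?N * q" by linarith
  ultimately have *: "p = ?N" "q = ?D"
    using D pq reduced_fraction_unique[of p q ?N ?D] by auto
  show "\<exists>r. p * cf_denom_shift as ?L - r * q = (-1) ^ ?L"
    using det unfolding *[symmetric] by blast
  show ge1: "?L \<ge> 2 \<longrightarrow> cf_denom_shift as ?L \<ge> 1"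
    using cf_denom_shift_pos[OF pos, of ?L] by (simp add: int_one_le_iff_zero_less)
  show "cf_denom_shift as ?L \<ge> 0"
    using ge1 L by (cases "?L = 1") auto
  show "?L = 1 \<longrightarrow> q = 1" by (simp add: *(2) numeral_2_eq_2)
qed

section \<open>Irrationality exponents from convergents\<close>

text \<open>Closeness to \<open>\<alpha>\<close> turns the bound on the denominator into one on the
  numerator, so \<open>quotient_of\<close> maps the set injectively into a finite box.\<close>

lemma finite_rats_bounded_denominator:
  fixes \<alpha> N :: real
  shows "finite {r :: rat. \<bar>\<alpha> - of_rat r\<bar> \<le> 1 \<and> real_of_int (snd (quotient_of r)) \<le> N}"
proof -
  define M where "M = \<lceil>N * (\<bar>\<alpha>\<bar> + 1)\<rceil>"
  have "quotient_of ` {r :: rat. \<bar>\<alpha> - of_rat r\<bar> \<le> 1 \<and> real_of_int (snd (quotient_of r)) \<le> N}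
      \<subseteq> {-M..M} \<times> {1..\<lfloor>N\<rfloor>}"
  proof safe
    fix r a b assume r: "\<bar>\<alpha> - of_rat r\<bar> \<le> 1" "real_of_int (snd (quotient_of r)) \<le> N"
      and ab: "(a, b) = quotient_of r"
    have b: "b > 0" "real_of_int b \<le> N" using quotient_of_denom_pos[OF ab[symmetric]] r ab[symmetric] by auto
    have "real_of_rat r = of_int a / of_int b"
      using quotient_of_div[OF ab[symmetric]] by (simp add: of_rat_divide)
    then have "\<bar>real_of_int a\<bar> = \<bar>real_of_rat r\<bar> * of_int b" using b by (simp add: abs_mult)
    also have "\<bar>real_of_rat r\<bar> \<le> \<bar>\<alpha>\<bar> + 1" using r(1) by linarith
    then have "\<bar>real_of_rat r\<bar> * of_int b \<le> (\<bar>\<alpha>\<bar> + 1) * N" using b by (intro mult_mono) auto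
    finally have "\<bar>real_of_int a\<bar> \<le> of_int M" unfolding M_def by (smt (verit) le_of_int_ceiling mult.commute)
    then show "a \<in> {-M..M}" by auto
    show "b \<in> {1..\<lfloor>N\<rfloor>}" using b by (simp add: le_floor_iff)
  qed
  then have "finite (quotient_of ` {r :: rat. \<bar>\<alpha> - of_rat r\<bar> \<le> 1 \<and> real_of_int (snd (quotient_of r)) \<le> N})"
    by (rule finite_subset) auto
  then show ?thesis
    by (rule finite_imageD) (auto simp: inj_on_def quotient_of_inject)
qed

text \<open>
  A rational close to \<open>\<alpha>\<close> that is none of the \<open>P k / Q k\<close> differs from the one with
  \<open>Q k \<le> 2 C b < Q (k + 1)\<close> by at least \<open>1 / (b Q k)\<close>, so it is only an approximation of order 2.
\<close>

lemma rational_approximation_cases: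
  fixes P Q :: "nat \<Rightarrow> int" and a b :: int and \<alpha> C :: real
  assumes C: "C > 0" and cop: "coprime (P k) (Q k)" and pos: "Q k > 0" "Q (Suc k) > 0"
    and up: "\<bar>\<alpha> - P k / Q k\<bar> \<le> C / (Q k * Q (Suc k))"
    and ab: "coprime a b" "b > 0" and le: "Q k \<le> 2 * C * b" and less: "2 * C * b < Q (Suc k)"
  shows "(a = P k \<and> b = Q k) \<or> 1 / (4 * C * (real_of_int b)\<^sup>2) \<le> \<bar>\<alpha> - a / b\<bar>"
proof (cases "a * Q k = P k * b")
  case True
  then have "a = P k \<and> b = Q k"
    using reduced_fraction_unique[of a b "P k" "Q k"] ab cop pos by auto
  then show ?thesis ..
next
  case False
  then have "1 \<le> \<bar>a * Q k - P k * b\<bar>" by linarith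
  then have "1 \<le> \<bar>real_of_int (a * Q k - P k * b)\<bar>" by linarith
  also have "\<dots> = b * Q k * \<bar>(\<alpha> - P k / Q k) - (\<alpha> - a / b)\<bar>"
  proof -
    have "real_of_int (a * Q k - P k * b) = b * Q k * ((\<alpha> - P k / Q k) - (\<alpha> - a / b))"
      using ab pos by (simp add: field_simps)
    then show ?thesis using ab pos by (simp add: abs_mult)
  qed
  also have "\<dots> \<le> b * Q k * (\<bar>\<alpha> - P k / Q k\<bar> + \<bar>\<alpha> - a / b\<bar>)"
    using ab pos by (intro mult_left_mono) auto
  also have "\<dots> \<le> b * Q k * (C / (Q k * Q (Suc k)) + \<bar>\<alpha> - a / b\<bar>)"
    using ab pos up by (intro mult_left_mono add_mono) auto
  also have "\<dots> = C * b / Q (Suc k) + b * Q k * \<bar>\<alpha> - a / b\<bar>"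
    using ab pos by (simp add: field_simps)
  \<comment> \<open>The factor 2 in \<open>less\<close> is chosen so that the error of the
    convergent uses up at most half of the integer gap 1.\<close>
  also have "C * b / Q (Suc k) \<le> 1 / 2" using less pos by (simp add: field_simps)
  finally have "1 / 2 \<le> b * Q k * \<bar>\<alpha> - a / b\<bar>" by simp
  also have "\<dots> \<le> b * (2 * C * b) * \<bar>\<alpha> - a / b\<bar>"
    using ab le by (intro mult_right_mono mult_left_mono) auto
  finally show ?thesis using ab C by (simp add: field_simps power2_eq_square)
qed

text \<open>Rationals outside the sequence are approximations of order at most 2, which
  \<open>\<mu> > 2\<close> excludes for large denominators. Members of the sequence have error at
  least c / Q^(1 + \<open>\<tau>\<close>), which \<open>\<mu> > 1 + \<tau>\<close> excludes. So the
  denominators are bounded.\<close>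

lemma finite_good_approximations:
  fixes P Q :: "nat \<Rightarrow> int" and \<alpha> c C :: real
  assumes cop: "\<forall>\<^sub>F k in sequentially. coprime (P k) (Q k)"
    and Q: "filterlim (\<lambda>k. real_of_int (Q k)) at_top sequentially"
    and C: "C > 0" and c: "c > 0"
    and low: "\<forall>\<^sub>F k in sequentially. c / (Q k * Q (Suc k)) \<le> \<bar>\<alpha> - P k / Q k\<bar>"
    and up: "\<forall>\<^sub>F k in sequentially. \<bar>\<alpha> - P k / Q k\<bar> \<le> C / (Q k * Q (Suc k))"
    and growth: "\<forall>\<^sub>F k in sequentially. ln (Q (Suc k)) \<le> \<tau> * ln (Q k)"
    and \<mu>: "\<mu> > 2" "\<mu> > 1 + \<tau>"
  shows "finite {r :: rat. \<bar>\<alpha> - of_rat r\<bar> < 1 / real_of_int (snd (quotient_of r)) powr \<mu>}"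
proof -
  have QS: "filterlim (\<lambda>k. real_of_int (Q (Suc k))) at_top sequentially"
    using Q by (rule filterlim_compose[OF _ filterlim_Suc])
  have lim: "((\<lambda>z::real. z powr (- e)) \<longlongrightarrow> 0) at_top" if "e > 0" for e
    using tendsto_neg_powr[of "-e" "\<lambda>z. z" at_top] that by (simp add: filterlim_ident)
  have "\<forall>\<^sub>F k in sequentially. (Q k) powr (- (\<mu> - 1 - \<tau>)) < c"
    using \<mu> by (intro order_tendstoD(2)[OF filterlim_compose[OF lim Q] c]) linarith
  moreover have "\<forall>\<^sub>F k in sequentially. Q k \<ge> (1::real)" "\<forall>\<^sub>F k in sequentially. Q (Suc k) \<ge> (1::real)"
    by (rule Q[unfolded filterlim_at_top, rule_format] QS[unfolded filterlim_at_top, rule_format])+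
  ultimately have "\<forall>\<^sub>F k in sequentially. coprime (P k) (Q k) \<and> c / (Q k * Q (Suc k)) \<le> \<bar>\<alpha> - P k / Q k\<bar>
      \<and> \<bar>\<alpha> - P k / Q k\<bar> \<le> C / (Q k * Q (Suc k)) \<and> ln (Q (Suc k)) \<le> \<tau> * ln (Q k)
      \<and> Q k \<ge> (1::real) \<and> Q (Suc k) \<ge> (1::real) \<and> (Q k) powr (- (\<mu> - 1 - \<tau>)) < c"
    using cop low up growth by eventually_elim blast
  then obtain K where K: "\<And>k. k \<ge> K \<Longrightarrow> coprime (P k) (Q k) \<and> c / (Q k * Q (Suc k)) \<le> \<bar>\<alpha> - P k / Q k\<bar>
      \<and> \<bar>\<alpha> - P k / Q k\<bar> \<le> C / (Q k * Q (Suc k)) \<and> ln (Q (Suc k)) \<le> \<tau> * ln (Q k)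
      \<and> Q k \<ge> (1::real) \<and> Q (Suc k) \<ge> (1::real) \<and> (Q k) powr (- (\<mu> - 1 - \<tau>)) < c"
    by (auto simp: eventually_sequentially)
  have "\<forall>\<^sub>F z :: real in at_top. z powr (- (\<mu> - 2)) < 1 / (4 * C)"
    using order_tendstoD(2)[OF lim, of "\<mu> - 2" "1 / (4 * C)"] \<mu> C by simp
  moreover have "\<forall>\<^sub>F z :: real in at_top. z \<ge> Q K / (2 * C)" by (rule eventually_ge_at_top)
  ultimately have "\<forall>\<^sub>F z :: real in at_top. z powr (- (\<mu> - 2)) < 1 / (4 * C) \<and> z \<ge> Q K / (2 * C)"
    by eventually_elim simp
  \<comment> \<open>Beyond \<open>N\<close> order 2 is too weak for the exponent
    \<open>\<mu>\<close>, and 2 C b has already passed \<open>Q K\<close>.\<close>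
  then obtain N where N: "\<And>z :: real. z \<ge> N \<Longrightarrow> z powr (- (\<mu> - 2)) < 1 / (4 * C) \<and> z \<ge> Q K / (2 * C)"
    by (auto simp: eventually_at_top_linorder)
  have "{r :: rat. \<bar>\<alpha> - of_rat r\<bar> < 1 / real_of_int (snd (quotient_of r)) powr \<mu>}
    \<subseteq> {r :: rat. \<bar>\<alpha> - of_rat r\<bar> \<le> 1 \<and> real_of_int (snd (quotient_of r)) \<le> N}"
  proof safe
    fix r :: rat assume r: "\<bar>\<alpha> - of_rat r\<bar> < 1 / real_of_int (snd (quotient_of r)) powr \<mu>"
    obtain a b where ab: "quotient_of r = (a, b)" by force
    have b: "b > 0" and cop: "coprime a b" using quotient_of_denom_pos quotient_of_coprime ab by auto
    have req: "real_of_rat r = of_int a / of_int b"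
      using quotient_of_div[OF ab] by (simp add: of_rat_divide)
    have r': "\<bar>\<alpha> - a / b\<bar> < 1 / b powr \<mu>" using r ab req by simp
    have "1 / b powr \<mu> \<le> 1" using b \<mu> by (simp add: ge_one_powr_ge_zero)
    then show "\<bar>\<alpha> - of_rat r\<bar> \<le> 1" using r' req by simp
    show "real_of_int (snd (quotient_of r)) \<le> N"
    proof (rule ccontr)
      assume "\<not> real_of_int (snd (quotient_of r)) \<le> N"
      then have bN: "b powr (- (\<mu> - 2)) < 1 / (4 * C)" "b \<ge> Q K / (2 * C)" using N[of b] ab by auto
      have ex: "\<exists>k. k \<ge> K \<and> 2 * C * b < Q (Suc k)"
        using eventually_conj[OF QS[unfolded filterlim_at_top_dense, rule_format, of "2 * C * b"] eventually_ge_at_top[of K]]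
          eventually_happens' sequentially_bot by blast
      \<comment> \<open>\<open>Q\<close> is not assumed monotone. Minimality gives
        \<open>Q k \<le> 2 * C * b\<close> when \<open>k > K\<close>, and the choice of
        \<open>N\<close> gives it when \<open>k = K\<close>.\<close>
      define k where "k = (LEAST k. k \<ge> K \<and> 2 * C * b < Q (Suc k))"
      have k: "k \<ge> K" "2 * C * b < Q (Suc k)"
        using LeastI_ex[OF ex] unfolding k_def by auto
      have Qk: "Q k \<le> 2 * C * b"
      proof (cases "k = K")
        case True
        then show ?thesis using bN C by (simp add: field_simps)
      next
        case False
        then have "k - 1 \<ge> K" "k - 1 < k" using k by auto
        then have "\<not> 2 * C * b < Q (Suc (k - 1))"
          using not_less_Least[of "k - 1" "\<lambda>k. k \<ge> K \<and> 2 * C * b < Q (Suc k)"] by (auto simp: k_def)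
        then show ?thesis using \<open>k - 1 < k\<close> by simp
      qed
      consider "a = P k" "b = Q k" | "1 / (4 * C * (real_of_int b)\<^sup>2) \<le> \<bar>\<alpha> - a / b\<bar>"
        using rational_approximation_cases[OF C, of P k Q \<alpha> a b] K[OF k(1)] cop b Qk k by auto
      then show False
      proof cases
        case 1
        let ?z = "real_of_int (Q k)"
        have z: "?z \<ge> 1" "Q (Suc k) \<ge> (1::real)" using K[OF k(1)] by auto
        have "ln (Q (Suc k)) \<le> ln (?z powr \<tau>)" using K[OF k(1)] z by (simp add: ln_powr)
        then have "Q (Suc k) \<le> ?z powr \<tau>" using z by (subst (asm) ln_le_cancel_iff) auto
        then have "?z * Q (Suc k) \<le> ?z * ?z powr \<tau>" using z by (intro mult_left_mono) auto
        also have "\<dots> = ?z powr (1 + \<tau>)" using z by (simp add: powr_add)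
        finally have "c / ?z powr (1 + \<tau>) \<le> c / (?z * Q (Suc k))"
          using z c by (intro divide_left_mono) auto
        also have "\<dots> < 1 / ?z powr \<mu>" using K[OF k(1)] r' 1 by auto
        finally have "c < ?z powr (1 + \<tau>) / ?z powr \<mu>" using z by (simp add: field_simps)
        also have "\<dots> = ?z powr (- (\<mu> - 1 - \<tau>))" by (simp add: algebra_simps flip: powr_diff)
        also have "\<dots> < c" using K[OF k(1)] by auto
        finally show False .
      next
        case 2
        then have "1 / (4 * C * (real_of_int b)\<^sup>2) < 1 / b powr \<mu>" using r' by simp
        then have "1 / (4 * C) < (real_of_int b)\<^sup>2 / b powr \<mu>" using b C by (simp add: field_simps)
        also have "\<dots> = b powr 2 / b powr \<mu>" using b by (simp add: powr_numeral)
        also have "\<dots> = b powr (- (\<mu> - 2))" by (simp flip: powr_diff)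
        finally show False using bN by simp
      qed
    qed
  qed
  then show ?thesis using finite_rats_bounded_denominator finite_subset by blast
qed

text \<open>Whenever Q' is at least Q^\<open>\<tau>\<close> for the next denominator Q', the error
  is at most C / Q^(1 + \<open>\<tau>\<close>), which is below 1 / Q^\<open>\<mu>\<close> for large
  Q. The lower bound \<open>low\<close> keeps the error nonzero.\<close>

lemma infinite_good_approximations:
  fixes P Q :: "nat \<Rightarrow> int" and \<alpha> c C :: real
  assumes cop: "\<forall>\<^sub>F k in sequentially. coprime (P k) (Q k)"
    and Q: "filterlim (\<lambda>k. real_of_int (Q k)) at_top sequentially"
    and C: "C > 0" and c: "c > 0"
    and low: "\<forall>\<^sub>F k in sequentially. c / (Q k * Q (Suc k)) \<le> \<bar>\<alpha> - P k / Q k\<bar>"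
    and up: "\<forall>\<^sub>F k in sequentially. \<bar>\<alpha> - P k / Q k\<bar> \<le> C / (Q k * Q (Suc k))"
    and growth: "\<exists>\<^sub>F k in sequentially. \<tau> * ln (Q k) \<le> ln (Q (Suc k))"
    and \<mu>: "\<mu> < 1 + \<tau>"
  shows "infinite {r :: rat. 0 < \<bar>\<alpha> - of_rat r\<bar> \<and>
      \<bar>\<alpha> - of_rat r\<bar> < 1 / real_of_int (snd (quotient_of r)) powr \<mu>}" (is "infinite ?S")
proof
  assume fin: "finite ?S"
  \<comment> \<open>\<open>M\<close> bounds every denominator in the allegedly finite set; inserting
    0 covers the empty set. The contradiction comes from some \<open>Q k > M\<close>.\<close>
  define M where "M = Max (insert 0 ((\<lambda>r. snd (quotient_of r)) ` ?S))"
  have M: "snd (quotient_of r) \<le> M" if "r \<in> ?S" for r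
    unfolding M_def using fin that by (intro Max_ge) auto
  have QS: "filterlim (\<lambda>k. real_of_int (Q (Suc k))) at_top sequentially"
    using Q by (rule filterlim_compose[OF _ filterlim_Suc])
  have lim: "((\<lambda>z::real. z powr (- e)) \<longlongrightarrow> 0) at_top" if "e > 0" for e
    using tendsto_neg_powr[of "-e" "\<lambda>z. z" at_top] that by (simp add: filterlim_ident)
  have "\<forall>\<^sub>F k in sequentially. (Q k) powr (- (1 + \<tau> - \<mu>)) < 1 / C"
    using \<mu> C by (intro order_tendstoD(2)[OF filterlim_compose[OF lim Q]]) auto
  moreover have "\<forall>\<^sub>F k in sequentially. Q k \<ge> (1::real)" "\<forall>\<^sub>F k in sequentially. Q (Suc k) \<ge> (1::real)"
    "\<forall>\<^sub>F k in sequentially. Q k > real_of_int M"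
    by (rule Q[unfolded filterlim_at_top, rule_format] QS[unfolded filterlim_at_top, rule_format]
        Q[unfolded filterlim_at_top_dense, rule_format])+
  ultimately have "\<forall>\<^sub>F k in sequentially. coprime (P k) (Q k) \<and> c / (Q k * Q (Suc k)) \<le> \<bar>\<alpha> - P k / Q k\<bar>
      \<and> \<bar>\<alpha> - P k / Q k\<bar> \<le> C / (Q k * Q (Suc k)) \<and> Q k > real_of_int M
      \<and> Q k \<ge> (1::real) \<and> Q (Suc k) \<ge> (1::real) \<and> (Q k) powr (- (1 + \<tau> - \<mu>)) < 1 / C"
    using cop low up by eventually_elim blast
  from frequently_eventually_conj[OF growth this]
  obtain k where k: "coprime (P k) (Q k)" "c / (Q k * Q (Suc k)) \<le> \<bar>\<alpha> - P k / Q k\<bar>"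
      "\<bar>\<alpha> - P k / Q k\<bar> \<le> C / (Q k * Q (Suc k))" "\<tau> * ln (Q k) \<le> ln (Q (Suc k))"  "Q k > real_of_int M"
      "Q k \<ge> (1::real)" "Q (Suc k) \<ge> (1::real)" "(Q k) powr (- (1 + \<tau> - \<mu>)) < 1 / C"
    using frequently_ex by fastforce
  let ?z = "real_of_int (Q k)"
  define r where "r = Fract (P k) (Q k)"
  have qr: "quotient_of r = (P k, Q k)"
    unfolding r_def using k by (simp add: quotient_of_Fract normalize_stable)
  have req: "real_of_rat r = P k / Q k" unfolding r_def using k by (simp add: of_rat_rat)
  have "0 < c / (Q k * Q (Suc k))" using k c by simp
  then have "0 < \<bar>\<alpha> - of_rat r\<bar>" using k(2) req by simp
  moreover have "\<bar>\<alpha> - of_rat r\<bar> < 1 / ?z powr \<mu>"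
  proof -
    have "ln (?z powr \<tau>) \<le> ln (Q (Suc k))" using k by (simp add: ln_powr)
    then have "?z powr \<tau> \<le> Q (Suc k)" using k by (subst (asm) ln_le_cancel_iff) auto
    then have "?z * ?z powr \<tau> \<le> ?z * Q (Suc k)" using k by (intro mult_left_mono) auto
    moreover have "?z * ?z powr \<tau> = ?z powr (1 + \<tau>)" using k by (simp add: powr_add)
    ultimately have "C / (?z * Q (Suc k)) \<le> C / ?z powr (1 + \<tau>)"
      using k C by (intro divide_left_mono) auto
    also have "\<dots> = C * (?z powr (- (1 + \<tau> - \<mu>)) / ?z powr \<mu>)" 
    proof -
      have "?z powr (- (1 + \<tau> - \<mu>)) / ?z powr \<mu> = ?z powr (- (1 + \<tau>))" by (simp flip: powr_diff)
      then show ?thesis by (metis powr_minus_divide times_divide_eq_right mult.right_neutral)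
    qed
    also have "\<dots> < C * (1 / C / ?z powr \<mu>)"
      using k C by (intro mult_strict_left_mono divide_strict_right_mono) auto
    also have "\<dots> = 1 / ?z powr \<mu>" using C by simp
    finally show ?thesis using k(3) req by simp
  qed
  ultimately have "r \<in> ?S" using qr by simp
  from M[OF this] show False using qr k by simp
qed

text \<open>
  The hypotheses on \<open>P\<close> and \<open>Q\<close> are those satisfied by the convergents of a continued fraction,
  up to constants.
\<close>

theorem irrationality_exponent_eqI:
  fixes P Q :: "nat \<Rightarrow> int" and \<alpha> c C :: real
  assumes cop: "\<forall>\<^sub>F k in sequentially. coprime (P k) (Q k)"
    and Q: "filterlim (\<lambda>k. real_of_int (Q k)) at_top sequentially"
    and C: "C > 0" and c: "c > 0"
    and low: "\<forall>\<^sub>F k in sequentially. c / (Q k * Q (Suc k)) \<le> \<bar>\<alpha> - P k / Q k\<bar>"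
    and up: "\<forall>\<^sub>F k in sequentially. \<bar>\<alpha> - P k / Q k\<bar> \<le> C / (Q k * Q (Suc k))"
    and lam: "lam \<ge> 2"
    and growth_le: "\<And>\<tau>. \<tau> > lam - 1 \<Longrightarrow> \<forall>\<^sub>F k in sequentially. ln (Q (Suc k)) \<le> \<tau> * ln (Q k)"
    and growth_ge: "\<And>\<tau>. \<tau> < lam - 1 \<Longrightarrow> \<exists>\<^sub>F k in sequentially. \<tau> * ln (Q k) \<le> ln (Q (Suc k))"
  shows "irrationality_exponent \<alpha> = ereal lam"
  unfolding irrationality_exponent_def
proof (rule antisym)
  let ?S = "\<lambda>\<mu>. {r :: rat. 0 < \<bar>\<alpha> - of_rat r\<bar> \<and>
      \<bar>\<alpha> - of_rat r\<bar> < 1 / real_of_int (snd (quotient_of r)) powr \<mu>}"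
  show "Sup {ereal \<mu> |\<mu>. infinite (?S \<mu>)} \<le> ereal lam"
  proof (rule Sup_least, clarify)
    fix \<mu> assume inf: "infinite (?S \<mu>)"
    have "\<mu> \<le> lam"
    proof (rule ccontr)
      assume "\<not> \<mu> \<le> lam"
      \<comment> \<open>The midpoint leaves room on both sides: \<open>\<tau>\<close> exceeds
        \<open>lam - 1\<close> while 1 + \<open>\<tau>\<close> stays below
        \<open>\<mu>\<close>.\<close>
      moreover then have "lam - 1 < (\<mu> + lam) / 2 - 1" by simp
      ultimately have "finite {r :: rat. \<bar>\<alpha> - of_rat r\<bar> < 1 / real_of_int (snd (quotient_of r)) powr \<mu>}"
        using lam growth_le[of "(\<mu> + lam) / 2 - 1"]
        by (intro finite_good_approximations[OF cop Q C c low up, of "(\<mu> + lam) / 2 - 1"]) auto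
      then have "finite (?S \<mu>)" by (rule finite_subset[rotated]) auto
      then show False using inf by contradiction
    qed
    then show "ereal \<mu> \<le> ereal lam" by simp
  qed
  show "ereal lam \<le> Sup {ereal \<mu> |\<mu>. infinite (?S \<mu>)}"
  proof (rule ereal_le_real, rule ccontr)
    fix z assume z: "Sup {ereal \<mu> |\<mu>. infinite (?S \<mu>)} \<le> ereal z" and "\<not> ereal lam \<le> ereal z"
    then have "z < lam" by simp
    \<comment> \<open>For \<open>z < lam\<close> the exponent \<open>(2 * z + lam) / 3\<close> lies
      strictly between \<open>z\<close> and the midpoint \<open>(z + lam) / 2\<close>, which is 1 +
      \<open>\<tau>\<close>.\<close>
    then have "infinite (?S ((2 * z + lam) / 3))"
      using growth_ge[of "(z + lam) / 2 - 1"]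
      by (intro infinite_good_approximations[OF cop Q C c low up, of "(z + lam) / 2 - 1"]) auto
    then have "ereal ((2 * z + lam) / 3) \<in> {ereal \<mu> |\<mu>. infinite (?S \<mu>)}" by blast
    then have "ereal ((2 * z + lam) / 3) \<le> ereal z" by (rule order_trans[OF Sup_upper z])
    then show False using \<open>z < lam\<close> by simp
  qed
qed

section \<open>Perturbed linear recurrences\<close>

text \<open>
  The characteristic roots are \<open>lam\<close> and \<open>1 / lam\<close>. Removing the second one leaves a quantity that
  grows at least like \<open>lam ^ n\<close>; removing the first one leaves an error \<open>O(\<nu> ^ n)\<close>.
\<close>

lemma perturbed_recurrence_ratio_tendsto:
  fixes X w :: "nat \<Rightarrow> real" and lam \<nu> :: real
  assumes lam: "lam > 1" and \<nu>: "1 < \<nu>" "\<nu> < lam"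
    and rec: "\<And>n. n \<ge> N \<Longrightarrow> X (Suc (Suc n)) = (lam + 1 / lam) * X (Suc n) - X n + w n"
    and w_upper: "\<And>n. n \<ge> N \<Longrightarrow> \<bar>w n\<bar> \<le> W * \<nu> ^ n"
    and w_lower: "\<And>n. n \<ge> N \<Longrightarrow> w n \<ge> - \<delta>"
    and X_nonneg: "\<And>n. n \<ge> N \<Longrightarrow> X n \<ge> 0"
    and diff: "filterlim (\<lambda>n. X (Suc n) - X n) at_top sequentially"
  shows "(\<lambda>n. X (Suc n) / X n) \<longlonglongrightarrow> lam"
proof -
  define Z where "Z n = X (Suc n) - X n / lam" for n
  define Y where "Y n = X (Suc n) - lam * X n" for n
  \<comment> \<open>\<open>e\<close> solves lam e = e + |\<open>\<delta>\<close>|, so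
    \<open>Z - e\<close> grows at least by the factor \<open>lam\<close> in each step despite the
    perturbation.\<close>
  define e where "e = \<bar>\<delta>\<bar> / (lam - 1)"
  have Z_rec: "Z (Suc n) = lam * Z n + w n" if "n \<ge> N" for n
    using rec[OF that] lam by (simp add: Z_def field_simps)
  have Y_rec: "Y (Suc n) = Y n / lam + w n" if "n \<ge> N" for n
    using rec[OF that] lam by (simp add: Y_def field_simps)
  \<comment> \<open>The divergent differences provide a starting index with
    \<open>Z K - e \<ge> 1\<close>, because \<open>Z\<close> is at least the difference of
    consecutive \<open>X\<close>.\<close>
  have "\<forall>\<^sub>F n in sequentially. n \<ge> N \<and> X (Suc n) - X n \<ge> e + 1"
    using diff[unfolded filterlim_at_top, rule_format, of "e + 1"] eventually_ge_at_top[of N]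
    by eventually_elim simp
  then obtain K where K: "K \<ge> N" "X (Suc K) - X K \<ge> e + 1"
    by (auto simp: eventually_sequentially)
  have Z_ge: "Z (K + i) - e \<ge> lam ^ i" for i
  proof (induction i)
    case 0
    have "X K / lam \<le> X K / 1" using lam X_nonneg[OF K(1)] by (intro divide_left_mono) auto
    then show ?case using K by (simp add: Z_def)
  next
    case (Suc i)
    have "lam * lam ^ i \<le> lam * (Z (K + i) - e)" using Suc lam by (intro mult_left_mono) auto
    also have "\<dots> = lam * Z (K + i) - \<bar>\<delta>\<bar> - e" using lam by (simp add: e_def field_simps)
    also have "\<dots> \<le> Z (K + Suc i) - e" using Z_rec[of "K + i"] w_lower[of "K + i"] K by simp
    finally show ?case by simp
  qed
  have X_ge: "X (K + Suc i) \<ge> lam ^ i" for i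
  proof -
    have "Z (K + i) \<le> X (K + Suc i)" using X_nonneg[of "K + i"] K lam by (simp add: Z_def)
    moreover have "e \<ge> 0" using lam by (simp add: e_def)
    ultimately show ?thesis using Z_ge[of i] by linarith
  qed
  define V where "V = W * \<nu> ^ K"
  \<comment> \<open>The second condition says B + V is at most B \<open>\<nu>\<close>, which is
    exactly what the induction for \<open>Y_le\<close> consumes.\<close>
  obtain B where B: "B \<ge> \<bar>Y K\<bar>" "B * (\<nu> - 1) \<ge> V"
  proof
    show "max \<bar>Y K\<bar> (V / (\<nu> - 1)) \<ge> \<bar>Y K\<bar>" by simp
    have "V = V / (\<nu> - 1) * (\<nu> - 1)" using \<nu> by simp
    also have "\<dots> \<le> max \<bar>Y K\<bar> (V / (\<nu> - 1)) * (\<nu> - 1)" using \<nu> by (intro mult_right_mono) auto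
    finally show "max \<bar>Y K\<bar> (V / (\<nu> - 1)) * (\<nu> - 1) \<ge> V" .
  qed
  have Y_le: "\<bar>Y (K + i)\<bar> \<le> B * \<nu> ^ i" for i
  proof (induction i)
    case (Suc i)
    have "\<bar>Y (K + Suc i)\<bar> \<le> \<bar>Y (K + i)\<bar> / lam + \<bar>w (K + i)\<bar>"
      using Y_rec[of "K + i"] K lam by (simp add: abs_triangle_ineq[THEN order_trans])
    also have "\<bar>Y (K + i)\<bar> / lam \<le> \<bar>Y (K + i)\<bar> / 1" using lam by (intro divide_left_mono) auto
    also have "\<bar>w (K + i)\<bar> \<le> V * \<nu> ^ i" using w_upper[of "K + i"] K by (simp add: V_def power_add)
    also have "\<bar>Y (K + i)\<bar> / 1 + V * \<nu> ^ i \<le> B * \<nu> ^ i + (B * (\<nu> - 1)) * \<nu> ^ i"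
      using Suc B \<nu> by (intro add_mono mult_right_mono) auto
    finally show ?case by (simp add: algebra_simps)
  qed (use B in simp)
  have "(\<lambda>i. (B * \<nu>) * (\<nu> / lam) ^ i) \<longlonglongrightarrow> (B * \<nu>) * 0"
    using \<nu> by (intro tendsto_mult_left LIMSEQ_power_zero) auto
  then have "(\<lambda>i. (B * \<nu>) * (\<nu> / lam) ^ i) \<longlonglongrightarrow> 0" by simp
  \<comment> \<open>The deviation of the ratio from \<open>lam\<close> is Y / X, with numerator
    \<open>O(\<nu> ^ i)\<close> and denominator at least \<open>lam ^ i\<close>.\<close>
  then have "(\<lambda>i. X (Suc (i + Suc K)) / X (i + Suc K) - lam) \<longlonglongrightarrow> 0"
  proof (rule tendsto_0_le[where K = 1], intro always_eventually allI)
    fix i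
    have pos: "X (i + Suc K) \<ge> lam ^ i" "lam ^ i > 0" using X_ge[of i] lam by (simp_all add: add.commute)
    then have "norm (X (Suc (i + Suc K)) / X (i + Suc K) - lam) = \<bar>Y (K + Suc i)\<bar> / X (i + Suc K)"
      by (simp add: Y_def field_simps add.commute abs_div_pos[symmetric] del: abs_divide)
    also have "\<dots> \<le> (B * \<nu> ^ Suc i) / lam ^ i" using pos Y_le[of "Suc i"] by (intro frac_le) auto
    also have "\<dots> = (B * \<nu>) * (\<nu> / lam) ^ i" by (simp add: power_divide)
    finally show "norm (X (Suc (i + Suc K)) / X (i + Suc K) - lam) \<le> norm ((B * \<nu>) * (\<nu> / lam) ^ i) * 1"
      by simp
  qed
  then have "(\<lambda>i. X (Suc (i + Suc K)) / X (i + Suc K)) \<longlonglongrightarrow> lam" by (simp add: LIM_zero_iff)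
  then show ?thesis by (rule LIMSEQ_offset)
qed

section \<open>Engel and Pierce type series\<close>

lemma eventually_even_odd:
  assumes "\<forall>\<^sub>F n in sequentially. R (2 * n)" "\<forall>\<^sub>F n in sequentially. R (Suc (2 * n))"
  shows "\<forall>\<^sub>F n in sequentially. R n"
proof -
  have "\<forall>\<^sub>F n in sequentially. R (2 * n) \<and> R (Suc (2 * n))" using assms by eventually_elim simp
  then obtain N where N: "\<And>n. n \<ge> N \<Longrightarrow> R (2 * n) \<and> R (Suc (2 * n))"
    by (auto simp: eventually_sequentially)
  have "R n" if "n \<ge> 2 * N" for n
    using N[of "n div 2"] that by (cases "even n") (auto elim!: evenE oddE)
  then show ?thesis by (auto simp: eventually_sequentially)
qed

text \<open>After division the term with index j is a bounded quotient times z^(-j), hence null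
  unless j = 0. It will give 1 + u x the same growth as \<open>v 0\<close> times x^d.\<close>

lemma sum_over_leading_term_tendsto:
  fixes v :: "nat \<Rightarrow> nat \<Rightarrow> real" and z :: "nat \<Rightarrow> real"
  assumes d: "d \<ge> 1" and z: "filterlim z at_top sequentially"
    and v0: "\<And>n. v 0 n > 0"
    and vj: "\<And>j. 1 \<le> j \<Longrightarrow> j \<le> d - 1 \<Longrightarrow> (\<lambda>n. v j n) \<in> O(\<lambda>n. v 0 n)"
  shows "(\<lambda>n. (\<Sum>j=0..<d. v j n * z n ^ (d - 1 - j)) / (v 0 n * z n ^ (d - 1))) \<longlonglongrightarrow> 1"
proof -
  have "(\<lambda>n. v j n / v 0 n * (1 / z n ^ j)) \<longlonglongrightarrow> (if j = 0 then 1 else 0)" if "j < d" for j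
  proof (cases "j = 0")
    case True
    then show ?thesis using v0 by (simp add: less_imp_neq[OF v0, symmetric])
  next
    case False
    then have "(\<lambda>n. v j n) \<in> O(\<lambda>n. v 0 n)" using vj[of j] that by simp
    then obtain c where "\<forall>\<^sub>F n in sequentially. norm (v j n) \<le> c * norm (v 0 n)"
      by (rule landau_o.bigE) blast
    then have bound: "\<forall>\<^sub>F n in sequentially. norm (v j n / v 0 n * (1 / z n ^ j)) \<le> norm (1 / z n ^ j) * c"
    proof eventually_elim
      case (elim n)
      then have "\<bar>v j n\<bar> / v 0 n \<le> c" using v0[of n] by (simp add: field_simps)
      then have "\<bar>v j n\<bar> / v 0 n * \<bar>1 / z n ^ j\<bar> \<le> c * \<bar>1 / z n ^ j\<bar>" by (intro mult_right_mono) auto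
      then show ?case using v0[of n] by (simp add: abs_mult mult.commute)
    qed
    have "(\<lambda>n. 1 / z n ^ j) \<longlonglongrightarrow> 0"
      using False by (intro tendsto_divide_0[OF tendsto_const] filterlim_at_top_imp_at_infinity filterlim_pow_at_top z) auto
    from tendsto_0_le[OF this bound] show ?thesis using False by simp
  qed
  then have "(\<lambda>n. \<Sum>j=0..<d. v j n / v 0 n * (1 / z n ^ j)) \<longlonglongrightarrow> (\<Sum>j=0..<d. if j = 0 then 1 else 0)"
    by (intro tendsto_sum) auto
  also have "(\<Sum>j=0..<d. if j = 0 then 1 else 0 :: real) = 1" using d by simp
  finally have lim: "(\<lambda>n. \<Sum>j=0..<d. v j n / v 0 n * (1 / z n ^ j)) \<longlonglongrightarrow> 1" .
  have "\<forall>\<^sub>F n in sequentially. (\<Sum>j=0..<d. v j n / v 0 n * (1 / z n ^ j))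
      = (\<Sum>j=0..<d. v j n * z n ^ (d - 1 - j)) / (v 0 n * z n ^ (d - 1))"
    using z[unfolded filterlim_at_top_dense, rule_format, of 0]
  proof eventually_elim
    case (elim n)
    show ?case unfolding sum_divide_distrib
    proof (rule sum.cong)
      fix j assume "j \<in> {0..<d}"
      then have "z n ^ (d - 1) = z n ^ (d - 1 - j) * z n ^ j" by (simp flip: power_add)
      then show "v j n / v 0 n * (1 / z n ^ j) = v j n * z n ^ (d - 1 - j) / (v 0 n * z n ^ (d - 1))"
        using elim v0[of n] by simp
    qed simp
  qed
  with lim show ?thesis by (rule Lim_transform_eventually)
qed

lemma abs_close_bounds:
  fixes a b :: real
  assumes "\<bar>a - b\<bar> \<le> \<epsilon>" "\<bar>b\<bar> = c" "\<epsilon> \<le> c / 2"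
  shows "c / 2 \<le> \<bar>a\<bar>" "\<bar>a\<bar> \<le> 3 / 2 * c"
  using assms by (auto simp: abs_if split: if_splits)

text \<open>
  The signs \<open>s\<close> and \<open>t\<close> cover the three constructions at once: \<open>(1, 1)\<close> for (E), \<open>(-1, 1)\<close> for (P1)
  and \<open>(-1, -1)\<close> for (P2). The congruence \<open>init\<close> is all that is needed of the expansion of \<open>p / q\<close>.
\<close>

locale signed_engel =
  fixes s t p q r y0 :: int and u x y :: "nat \<Rightarrow> int" and \<alpha> :: real
  assumes s: "s = 1 \<or> s = -1" and t: "t = 1 \<or> t = -1"
    and q_pos: "q \<ge> 1" and y0_pos: "y0 \<ge> 1"
    and u_pos: "\<And>n. n \<ge> 1 \<Longrightarrow> u n > 0"
    and rec: "xy_recursion q y0 u x y"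
    and init: "q * r - p * (y0 - s) = t"
    and \<alpha>: "\<alpha> = p / q + t * (\<Sum>j. of_int (s ^ (j + 2)) / x (j + 2))"
begin

section \<open>Positivity and growth of \<open>x\<close> and \<open>y\<close>\<close>

lemma y_0: "y 0 = y0" and x_1: "x (Suc 0) = q"
  and y_Suc: "y (Suc n) = y n * (1 + u (Suc n) * x (Suc n))"
  and x_Suc: "x (Suc (Suc n)) = x (Suc n) * y (Suc n)"
  using rec by (auto simp: xy_recursion_def)

lemma xy_pos: "x (Suc n) \<ge> 1 \<and> y n \<ge> 1"
proof (induction n)
  case (Suc n)
  then have "1 + u (Suc n) * x (Suc n) \<ge> 1" using u_pos[of "Suc n"] by simp
  then have "y (Suc n) \<ge> 1 * 1" unfolding y_Suc using Suc by (intro mult_mono) auto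
  moreover then have "x (Suc (Suc n)) \<ge> 1 * 1" unfolding x_Suc using Suc by (intro mult_mono) auto
  ultimately show ?case by simp
qed (use y_0 x_1 q_pos y0_pos in auto)

lemma x_pos: "x (Suc n) \<ge> 1" and y_pos: "y n \<ge> 1"
  using xy_pos by auto

lemma y_Suc_ge: "y (Suc n) \<ge> y n * (1 + x (Suc n))"
proof -
  have "x (Suc n) * 1 \<le> x (Suc n) * u (Suc n)"
    using u_pos[of "Suc n"] x_pos[of n] by (intro mult_left_mono) auto
  then show ?thesis unfolding y_Suc using y_pos[of n] by (intro mult_left_mono) (auto simp: mult.commute)
qed

lemma y_double: "y (Suc n) \<ge> 2 * y n"
proof -
  have "y n * 2 \<le> y n * (1 + x (Suc n))" using x_pos[of n] y_pos[of n] by (intro mult_left_mono) auto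
  then show ?thesis using y_Suc_ge[of n] by linarith
qed

lemma x_double: "x (Suc (Suc n)) \<ge> 2 * x (Suc n)"
proof -
  have "x (Suc n) * 2 \<le> x (Suc n) * y (Suc n)"
    using x_pos[of n] y_pos[of n] y_double[of n] by (intro mult_left_mono) auto
  then show ?thesis by (simp add: x_Suc)
qed

lemma x_shift_ge: "x (Suc n) * 2 ^ i \<le> x (Suc n + i)"
proof (induction i)
  case (Suc i)
  then show ?case using x_double[of "n + i"] by simp
qed simp

lemma x_ge_pow: "2 ^ n \<le> x (Suc n)"
proof -
  have "1 * 2 ^ n \<le> q * 2 ^ n" using q_pos by (intro mult_right_mono) auto
  also have "\<dots> \<le> x (Suc n)" using x_shift_ge[of 0 n] x_1 by simp
  finally show ?thesis by simp
qed

lemma y_ge_pow: "2 ^ n \<le> y n"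
proof (induction n)
  case (Suc n)
  then show ?case using y_double[of n] by simp
qed (use y_pos in simp)

section \<open>Remainders of the signed series\<close>

lemma abs_s_power: "\<bar>real_of_int (s ^ k)\<bar> = 1"
  using s by (auto simp: power_abs)

definition tail :: "nat \<Rightarrow> real" where
  "tail n = (\<Sum>i. of_int (s ^ (Suc n + i)) / x (Suc n + i))"

text \<open>Since \<open>x\<close> at least doubles at each step, a geometric series dominates; this
  gives convergence and bounds each remainder by twice the size of its first term.\<close>

lemma term_bound: "norm (of_int (s ^ (Suc n + i)) / real_of_int (x (Suc n + i))) \<le> 1 / x (Suc n) * (1 / 2) ^ i"
proof -
  have "norm (of_int (s ^ (Suc n + i)) / real_of_int (x (Suc n + i))) = 1 / x (Suc n + i)"
    using x_pos[of "n + i"] abs_s_power[of "Suc n + i"] by (simp add: del: of_int_power power_Suc)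
  also have "\<dots> \<le> 1 / of_int (x (Suc n) * 2 ^ i)"
    using x_shift_ge[of n i] x_pos[of n] x_pos[of "n + i"]
    by (intro divide_left_mono mult_pos_pos) (simp_all del: of_int_mult)
  finally show ?thesis by (simp add: power_divide)
qed

lemma geometric_bound: "summable (\<lambda>i. 1 / real_of_int (x (Suc n)) * (1 / 2) ^ i)"
  by (intro summable_mult) (simp add: summable_geometric)

lemma tail_summable: "summable (\<lambda>i. of_int (s ^ (Suc n + i)) / real_of_int (x (Suc n + i)))"
  using term_bound geometric_bound by (rule summable_comparison_test'[rotated])

lemma tail_bound: "\<bar>tail n\<bar> \<le> 2 / x (Suc n)"
proof -
  have "norm (tail n) \<le> (\<Sum>i. 1 / x (Suc n) * (1 / 2) ^ i)"
    unfolding tail_def using term_bound by (rule norm_suminf_le) (rule geometric_bound)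
  also have "\<dots> = 2 / x (Suc n)"
    by (subst suminf_mult) (simp_all add: summable_geometric suminf_geometric)
  finally show ?thesis by simp
qed

lemma tail_Suc: "tail n = of_int (s ^ Suc n) / x (Suc n) + tail (Suc n)"
  using suminf_split_head[OF tail_summable[of n]] by (simp add: tail_def)

text \<open>Numerators belonging to the denominators \<open>x (n + 1)\<close> and \<open>y n - s\<close>.\<close>

fun num_x num_y :: "nat \<Rightarrow> int" where
  "num_x 0 = p"
| "num_x (Suc n) = num_x n * y (Suc n) + t * s ^ Suc (Suc n)"
| "num_y 0 = r"
| "num_y (Suc n) = u (Suc n) * y n * num_x n + num_y n"

text \<open>Passing from \<open>y n\<close> to \<open>y (Suc n)\<close> adds the same multiple of
  \<open>x (Suc n)\<close> and \<open>num_x n\<close> to the other pair, so the determinant is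
  unchanged. Passing to the next \<open>x\<close> multiplies it by \<open>s\<close>. The initial
  value is the hypothesis \<open>init\<close>.\<close>

lemma determinants:
  "x (Suc n) * num_y n - num_x n * (y n - s) = t * s ^ n"
  "x (Suc n) * num_y (Suc n) - num_x n * (y (Suc n) - s) = t * s ^ n"
proof -
  have step: "x (Suc n) * num_y (Suc n) - num_x n * (y (Suc n) - s) = x (Suc n) * num_y n - num_x n * (y n - s)" for n
    by (simp add: y_Suc algebra_simps)
  show 1: "x (Suc n) * num_y n - num_x n * (y n - s) = t * s ^ n"
  proof (induction n)
    case 0
    then show ?case using init by (simp add: x_1 y_0)
  next
    case (Suc n)
    have "x (Suc (Suc n)) * num_y (Suc n) - num_x (Suc n) * (y (Suc n) - s)
      = y (Suc n) * (x (Suc n) * num_y (Suc n) - num_x n * (y (Suc n) - s))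
        - t * s ^ Suc (Suc n) * (y (Suc n) - s)"
      by (simp add: x_Suc algebra_simps)
    also have "\<dots> = y (Suc n) * (t * s ^ n) - t * s ^ Suc (Suc n) * (y (Suc n) - s)"
      unfolding step Suc ..
    \<comment> \<open>As s^2 = 1, the terms with \<open>y\<close> cancel and t s^(n + 3) = t s^(n +
      1) remains.\<close>
    also have "\<dots> = t * s ^ Suc n"
      using s by (auto simp: algebra_simps)
    finally show ?case .
  qed
  show "x (Suc n) * num_y (Suc n) - num_x n * (y (Suc n) - s) = t * s ^ n"
    using step 1 by simp
qed

lemma coprime_of_det:
  assumes "a * b - c * d = t * s ^ n"
  shows "coprime c a" "coprime b d"
proof -
  have "is_unit (t * s ^ n)" using t s by (auto simp: minus_one_power_iff)
  then have unit: "is_unit (a * b - c * d)" using assms by simp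
  show "coprime c a" "coprime b d"
    by (rule coprimeI, rule dvd_trans[OF _ unit], simp)+
qed

lemma coprime_num_x: "coprime (num_x n) (x (Suc n))"
  and coprime_num_y: "coprime (num_y n) (y n - s)"
  using coprime_of_det[OF determinants(1)] by auto

text \<open>Each \<open>x\<close> divides the next, and \<open>num_x n\<close> is the numerator of
  the partial sum over the common denominator \<open>x (Suc n)\<close>.\<close>

lemma \<alpha>_eq: "\<alpha> - num_x n / x (Suc n) = t * tail (Suc n)"
proof (induction n)
  case 0
  show ?case using \<alpha> by (simp add: tail_def x_1)
next
  case (Suc n)
  have "num_x (Suc n) / x (Suc (Suc n)) = num_x n / x (Suc n) + t * (of_int (s ^ Suc (Suc n)) / x (Suc (Suc n)))"
    using x_pos[of n] y_pos[of "Suc n"] by (simp add: x_Suc field_simps)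
  then show ?case using Suc tail_Suc[of "Suc n"] by (simp add: algebra_simps)
qed

section \<open>Two-sided error bounds\<close>

lemma unit_abs: "\<bar>real_of_int (t * s ^ n)\<bar> = 1"
  using abs_s_power[of n] t by auto

text \<open>The first omitted term of the series is the main part of the error; the bound is that of
  the remainder after it.\<close>

lemma \<alpha>_approx:
  "\<bar>(\<alpha> - num_x n / x (Suc n)) - t * s ^ n / x (Suc (Suc n))\<bar> \<le> 2 / (x (Suc (Suc n)) * y (Suc (Suc n)))"
proof -
  have sq: "s ^ Suc (Suc n) = s ^ n" using s by auto
  have "(\<alpha> - num_x n / x (Suc n)) - t * s ^ n / x (Suc (Suc n)) = t * tail (Suc (Suc n))"
    unfolding \<alpha>_eq tail_Suc[of "Suc n"] sq by (simp add: algebra_simps)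
  then show ?thesis using tail_bound[of "Suc (Suc n)"] t by (auto simp: x_Suc[of "Suc n"])
qed

text \<open>The error is 1 / (x y) up to the factors 1/2 and 3/2. As \<open>y \<ge> 2\<close>,
  replacing \<open>y\<close> by \<open>y - s\<close> costs at most another factor 2, whence 1/4 and
  3.\<close>

lemma approximation_x:
  fixes n :: nat
  defines "D \<equiv> x (Suc n) * (y (Suc n) - s)"
  shows "(1/4) / D \<le> \<bar>\<alpha> - num_x n / x (Suc n)\<bar>" "\<bar>\<alpha> - num_x n / x (Suc n)\<bar> \<le> 3 / D"
proof -
  have Y: "y (Suc n) \<ge> 2" using y_double[of n] y_pos[of n] by linarith
  have X: "x (Suc n) \<ge> 1" "x (Suc (Suc n)) \<ge> 1" using x_pos by auto
  have Y': "y (Suc (Suc n)) \<ge> 4" using y_double[of "Suc n"] Y by linarith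
  define E where "E = 1 / real_of_int (x (Suc (Suc n)))"
  have unit: "\<bar>t * s ^ n / x (Suc (Suc n))\<bar> = E"
    using unit_abs[of n] X by (simp add: E_def del: of_int_mult of_int_power)
  have small: "2 / (x (Suc (Suc n)) * y (Suc (Suc n))) \<le> E / 2"
    using X Y' by (simp add: E_def field_simps)
  have E: "E / 2 \<le> \<bar>\<alpha> - num_x n / x (Suc n)\<bar>" "\<bar>\<alpha> - num_x n / x (Suc n)\<bar> \<le> 3 / 2 * E"
    by (rule abs_close_bounds[OF \<alpha>_approx[of n] unit small])+
  have D: "D > 0" using X Y s by (auto simp: D_def)
  have *: "real_of_int D \<le> 2 * x (Suc (Suc n))" "real_of_int (x (Suc (Suc n))) \<le> 2 * D"
  proof -
    have "D \<le> x (Suc n) * (2 * y (Suc n))" "x (Suc n) * y (Suc n) \<le> x (Suc n) * (2 * (y (Suc n) - s))"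
      unfolding D_def using X Y s by (intro mult_left_mono; auto)+
    then have "D \<le> 2 * x (Suc (Suc n))" "x (Suc (Suc n)) \<le> 2 * D"
      by (simp_all add: x_Suc D_def algebra_simps)
    then show "real_of_int D \<le> 2 * x (Suc (Suc n))" "real_of_int (x (Suc (Suc n))) \<le> 2 * D" by linarith+
  qed
  have "(1/4) / D \<le> E / 2" "3 / 2 * E \<le> 3 / D"
    using * D X by (simp_all add: E_def field_simps)
  then show "(1/4) / D \<le> \<bar>\<alpha> - num_x n / x (Suc n)\<bar>" "\<bar>\<alpha> - num_x n / x (Suc n)\<bar> \<le> 3 / D"
    using E by linarith+
qed

text \<open>By the determinant this fraction exceeds the previous one by \<open>t * s ^ n\<close> /
  (x (y - s)), which nearly cancels the first omitted term \<open>t * s ^ n\<close> / (x y). The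
  difference of the two has absolute value exactly 1 / D and dominates the remainder.\<close>

lemma approximation_y:
  fixes n :: nat
  assumes "n \<ge> 2"
  defines "D \<equiv> (y (Suc n) - s) * x (Suc (Suc n))"
  shows "(1/4) / D \<le> \<bar>\<alpha> - num_y (Suc n) / (y (Suc n) - s)\<bar>" "\<bar>\<alpha> - num_y (Suc n) / (y (Suc n) - s)\<bar> \<le> 3 / D"
proof -
  have Y: "y (Suc n) \<ge> 2" using y_double[of n] y_pos[of n] by linarith
  have X: "x (Suc n) \<ge> 1" "x (Suc (Suc n)) \<ge> 1" using x_pos by auto
  have Y1: "y (Suc n) - s \<ge> 1" using Y s by auto
  have D: "D > 0" using X Y1 by (auto simp: D_def)
  \<comment> \<open>The assumption \<open>n \<ge> 2\<close> makes the next \<open>x\<close> at least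
    8, so the next \<open>y\<close> is at least 4 (y - s) and the remainder is at most half of 1 /
    D.\<close>
  have "(2::int) ^ 3 \<le> 2 ^ Suc n" using assms by (intro power_increasing) auto
  then have x8: "x (Suc (Suc n)) \<ge> 8" using x_ge_pow[of "Suc n"] by simp
  have "4 * (y (Suc n) - s) \<le> y (Suc n) * 8" using Y s by auto
  also have "\<dots> \<le> y (Suc n) * (1 + x (Suc (Suc n)))" using x8 Y by (intro mult_left_mono) auto
  also have "\<dots> \<le> y (Suc (Suc n))" by (rule y_Suc_ge)
  finally have y4: "4 * (y (Suc n) - s) \<le> y (Suc (Suc n))" .
  have num: "num_y (Suc n) / real_of_int (y (Suc n) - s) - num_x n / x (Suc n) = t * s ^ n / (x (Suc n) * (y (Suc n) - s))"
  proof -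
    have "real_of_int (x (Suc n) * num_y (Suc n) - num_x n * (y (Suc n) - s)) = of_int (t * s ^ n)"
      unfolding determinants ..
    then show ?thesis using X Y1 by (simp add: field_simps)
  qed
  have "t * s ^ n / x (Suc (Suc n)) - t * s ^ n / (x (Suc n) * (y (Suc n) - s))
      = - (s * (t * s ^ n) / D)"
    using X Y Y1 unfolding D_def x_Suc
    by (simp add: divide_simps) (simp add: algebra_simps)
  then have "(\<alpha> - num_x n / x (Suc n)) - t * s ^ n / x (Suc (Suc n))
      = (\<alpha> - num_y (Suc n) / (y (Suc n) - s)) + s * (t * s ^ n) / D"
    using num by linarith
  then have close: "\<bar>(\<alpha> - num_y (Suc n) / (y (Suc n) - s)) - (- (s * (t * s ^ n) / D))\<bar>
      \<le> 2 / (x (Suc (Suc n)) * y (Suc (Suc n)))"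
    using \<alpha>_approx[of n] by simp
  have small: "2 / (x (Suc (Suc n)) * y (Suc (Suc n))) \<le> (1 / real_of_int D) / 2"
  proof -
    have "real_of_int (x (Suc (Suc n)) * (4 * (y (Suc n) - s))) \<le> real_of_int (x (Suc (Suc n)) * y (Suc (Suc n)))"
      using X y4 unfolding of_int_le_iff by (intro mult_left_mono) auto
    then have "4 * real_of_int D \<le> x (Suc (Suc n)) * y (Suc (Suc n))"
      by (simp add: D_def algebra_simps)
    then have "2 / (x (Suc (Suc n)) * y (Suc (Suc n))) \<le> 2 / (4 * real_of_int D)"
      using D by (intro divide_left_mono) auto
    then show ?thesis by simp
  qed
  have unit: "\<bar>- (s * (t * s ^ n) / D)\<bar> = 1 / real_of_int D"
    using unit_abs[of n] s D by (auto simp del: of_int_mult of_int_power)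
  have le: "(1/4) / real_of_int D \<le> (1 / real_of_int D) / 2" "3 / 2 * (1 / real_of_int D) \<le> 3 / real_of_int D"
    using D by (simp_all add: field_simps)
  show "(1/4) / D \<le> \<bar>\<alpha> - num_y (Suc n) / (y (Suc n) - s)\<bar>" "\<bar>\<alpha> - num_y (Suc n) / (y (Suc n) - s)\<bar> \<le> 3 / D"
    by (rule order_trans[OF le(1) abs_close_bounds(1)[OF close unit small]]
      order_trans[OF abs_close_bounds(2)[OF close unit small] le(2)])+
qed

section \<open>From growth of denominators to the exponent\<close>

text \<open>In this order the product of two neighbouring denominators is the \<open>D\<close> of
  \<open>approximation_x\<close> or of \<open>approximation_y\<close>.\<close>

definition conv_denom :: "nat \<Rightarrow> int" where
  "conv_denom k = (if even k then x (Suc (k div 2)) else y (Suc (k div 2)) - s)"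

definition conv_num :: "nat \<Rightarrow> int" where
  "conv_num k = (if even k then num_x (k div 2) else num_y (Suc (k div 2)))"

lemma conv_simps [simp]:
  "conv_denom (2 * n) = x (Suc n)" "conv_denom (Suc (2 * n)) = y (Suc n) - s"
  "conv_denom (Suc (Suc (2 * n))) = x (Suc (Suc n))"
  "conv_num (2 * n) = num_x n" "conv_num (Suc (2 * n)) = num_y (Suc n)"
  by (auto simp: conv_denom_def conv_num_def)

lemma x_at_top: "filterlim (\<lambda>n. real_of_int (x (Suc n))) at_top sequentially"
proof (rule filterlim_at_top_mono[OF filterlim_real_sequentially], intro always_eventually allI)
  fix n
  have "int n < 2 ^ n" by (rule of_nat_less_two_power)
  then have "int n \<le> x (Suc n)" using x_ge_pow[of n] by linarith
  then show "real n \<le> x (Suc n)" by linarith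
qed

lemma y_at_top: "filterlim (\<lambda>n. real_of_int (y n)) at_top sequentially"
proof (rule filterlim_at_top_mono[OF filterlim_real_sequentially], intro always_eventually allI)
  fix n
  have "int n < 2 ^ n" by (rule of_nat_less_two_power)
  then have "int n \<le> y n" using y_ge_pow[of n] by linarith
  then show "real n \<le> y n" by linarith
qed

text \<open>Since \<open>x (Suc (Suc n))\<close> is \<open>x (Suc n)\<close> times
  \<open>y (Suc n)\<close>, the logarithm of \<open>y - s\<close> is a difference of consecutive ln
  x up to o(1). Hence the logarithmic ratios tend to \<open>lam - 1\<close> along even and to
  \<open>lam / (lam - 1)\<close> along odd indices.\<close>

lemma irrationality_exponent_of_growth:
  assumes ratio: "(\<lambda>n. ln (x (Suc (Suc n))) / ln (x (Suc n))) \<longlonglongrightarrow> lam"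
    and lam: "lam \<ge> 2" "lam / (lam - 1) \<le> lam - 1"
  shows "irrationality_exponent \<alpha> = ereal lam"
proof -
  define L where "L n = ln (real_of_int (x (Suc n)))" for n
  \<comment> \<open>The effect of the shift by \<open>s\<close>, which vanishes in the
    limit.\<close>
  define D where "D n = ln (real_of_int (y (Suc n) - s)) - ln (real_of_int (y (Suc n)))" for n
  have L_top: "filterlim L at_top sequentially"
    unfolding L_def using filterlim_compose[OF ln_at_top x_at_top] .
  have yS: "filterlim (\<lambda>n. real_of_int (y (Suc n))) at_top sequentially"
    by (rule filterlim_compose[OF y_at_top filterlim_Suc])
  have y2: "y (Suc n) \<ge> 2" for n using y_double[of n] y_pos[of n] by linarith
  have y1: "y (Suc n) - s \<ge> 1" for n using y2[of n] s by auto
  have "(\<lambda>n. ln (1 - s / y (Suc n))) \<longlonglongrightarrow> ln (1 - 0)"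
    by (intro tendsto_ln tendsto_diff tendsto_const tendsto_divide_0[OF tendsto_const]
        filterlim_at_top_imp_at_infinity[OF yS]) simp
  moreover have "ln (1 - s / y (Suc n)) = D n" for n
  proof -
    have "1 - s / y (Suc n) = real_of_int (y (Suc n) - s) / y (Suc n)"
      using y2[of n] by (simp add: field_simps)
    then show ?thesis using y1[of n] y2[of n] by (simp add: D_def ln_div)
  qed
  ultimately have D0: "D \<longlonglongrightarrow> 0" by simp
  have DL: "(\<lambda>n. D n / L n) \<longlonglongrightarrow> 0"
    by (rule tendsto_divide_0[OF D0 filterlim_at_top_imp_at_infinity[OF L_top]])
  have ln_y: "ln (real_of_int (y (Suc n) - s)) = L (Suc n) - L n + D n" for n
    using x_pos[of n] y2[of n] by (simp add: L_def D_def x_Suc ln_mult)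
  have ratio': "(\<lambda>n. L (Suc n) / L n) \<longlonglongrightarrow> lam" using ratio by (simp add: L_def)
  have even: "(\<lambda>n. L (Suc n) / L n - 1 + D n / L n) \<longlonglongrightarrow> lam - 1"
    using tendsto_add[OF tendsto_diff[OF ratio' tendsto_const[of 1]] DL] by simp
  have odd: "(\<lambda>n. (L (Suc n) / L n) / (L (Suc n) / L n - 1 + D n / L n)) \<longlonglongrightarrow> lam / (lam - 1)"
    using lam by (intro tendsto_divide ratio' even) auto
  have L_pos: "\<forall>\<^sub>F n in sequentially. L n > 0"
    using L_top by (auto simp: filterlim_at_top_dense)
  have even_eq: "\<forall>\<^sub>F n in sequentially. L n > 0 \<and> 
      ln (real_of_int (conv_denom (Suc (2 * n)))) = (L (Suc n) / L n - 1 + D n / L n) * L n"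
    using L_pos
  proof eventually_elim
    case (elim n)
    then show ?case unfolding conv_simps ln_y by (simp add: field_simps)
  qed
  show ?thesis
  proof (rule irrationality_exponent_eqI[where P = conv_num and Q = conv_denom and c = "1/4" and C = 3])
    show "\<forall>\<^sub>F k in sequentially. coprime (conv_num k) (conv_denom k)"
      by (rule always_eventually) (simp add: conv_num_def conv_denom_def coprime_num_x coprime_num_y del: num_x.simps num_y.simps)
    show "filterlim (\<lambda>k. real_of_int (conv_denom k)) at_top sequentially"
      unfolding filterlim_at_top
    proof (rule allI, rule eventually_even_odd; unfold conv_simps)
      fix Z :: real
      show "\<forall>\<^sub>F n in sequentially. Z \<le> x (Suc n)"
        by (rule x_at_top[unfolded filterlim_at_top, rule_format])
      have "\<forall>\<^sub>F n in sequentially. Z + 1 \<le> y (Suc n)" by (rule yS[unfolded filterlim_at_top, rule_format])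
      then show "\<forall>\<^sub>F n in sequentially. Z \<le> real_of_int (y (Suc n) - s)"
        by eventually_elim (use s in auto)
    qed
    show "\<forall>\<^sub>F k in sequentially. 1 / 4 / (conv_denom k * conv_denom (Suc k)) \<le> \<bar>\<alpha> - conv_num k / conv_denom k\<bar>"
    proof (rule eventually_even_odd; unfold conv_simps)
      show "\<forall>\<^sub>F n in sequentially. 1 / 4 / (x (Suc n) * (y (Suc n) - s)) \<le> \<bar>\<alpha> - num_x n / x (Suc n)\<bar>"
        by (intro always_eventually allI approximation_x)
      show "\<forall>\<^sub>F n in sequentially. 1 / 4 / ((y (Suc n) - s) * x (Suc (Suc n))) \<le> \<bar>\<alpha> - num_y (Suc n) / (y (Suc n) - s)\<bar>"
        using eventually_ge_at_top[of 2] by eventually_elim (rule approximation_y)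
    qed
    show "\<forall>\<^sub>F k in sequentially. \<bar>\<alpha> - conv_num k / conv_denom k\<bar> \<le> 3 / (conv_denom k * conv_denom (Suc k))"
    proof (rule eventually_even_odd; unfold conv_simps)
      show "\<forall>\<^sub>F n in sequentially. \<bar>\<alpha> - num_x n / x (Suc n)\<bar> \<le> 3 / (x (Suc n) * (y (Suc n) - s))"
        by (intro always_eventually allI approximation_x)
      show "\<forall>\<^sub>F n in sequentially. \<bar>\<alpha> - num_y (Suc n) / (y (Suc n) - s)\<bar> \<le> 3 / ((y (Suc n) - s) * x (Suc (Suc n)))"
        using eventually_ge_at_top[of 2] by eventually_elim (rule approximation_y)
    qed
    show "\<forall>\<^sub>F k in sequentially. ln (conv_denom (Suc k)) \<le> \<tau> * ln (conv_denom k)" if "\<tau> > lam - 1" for \<tau>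
    proof (rule eventually_even_odd)
      have "\<forall>\<^sub>F n in sequentially. L (Suc n) / L n - 1 + D n / L n < \<tau>"
        using order_tendstoD(2)[OF even that] .
      then show "\<forall>\<^sub>F n in sequentially. ln (conv_denom (Suc (2 * n))) \<le> \<tau> * ln (conv_denom (2 * n))"
        using even_eq
      proof eventually_elim
        case (elim n)
        then have "ln (conv_denom (Suc (2 * n))) \<le> \<tau> * L n"
          by (metis less_imp_le mult_right_mono)
        then show ?case by (simp add: L_def)
      qed
      have "\<forall>\<^sub>F n in sequentially. (L (Suc n) / L n) / (L (Suc n) / L n - 1 + D n / L n) < \<tau>"
        \<comment> \<open>Here \<open>lam / (lam - 1) \<le> lam - 1\<close> enters: the odd indices
          do not raise the limit superior.\<close>
        by (rule order_tendstoD(2)[OF odd]) (use lam that in linarith)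
      moreover have "\<forall>\<^sub>F n in sequentially. L (Suc n) / L n - 1 + D n / L n > 0"
        by (rule order_tendstoD(1)[OF even]) (use lam in linarith)
      ultimately show "\<forall>\<^sub>F n in sequentially. ln (conv_denom (Suc (Suc (2 * n)))) \<le> \<tau> * ln (conv_denom (Suc (2 * n)))"
        using even_eq
      proof eventually_elim
        case (elim n)
        let ?g = "L (Suc n) / L n - 1 + D n / L n"
        have "L (Suc n) / L n \<le> \<tau> * ?g" using elim(1) unfolding pos_divide_less_eq[OF elim(2)] by (rule less_imp_le)
        then have "L (Suc n) / L n * L n \<le> \<tau> * ?g * L n" using elim(3) by (intro mult_right_mono) auto
        moreover have "L (Suc n) / L n * L n = L (Suc n)" using elim(3) by simp
        moreover have "\<tau> * ?g * L n = \<tau> * ln (conv_denom (Suc (2 * n)))"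
          using conjunct2[OF elim(3)] by (simp only: mult.assoc)
        ultimately have "L (Suc n) \<le> \<tau> * ln (conv_denom (Suc (2 * n)))" by argo
        then show ?case by (simp only: L_def conv_simps)
      qed
    qed
    show "\<exists>\<^sub>F k in sequentially. \<tau> * ln (conv_denom k) \<le> ln (conv_denom (Suc k))" if "\<tau> < lam - 1" for \<tau>
    proof -
      \<comment> \<open>The even indices alone attain the limit superior.\<close>
      have "\<forall>\<^sub>F n in sequentially. L (Suc n) / L n - 1 + D n / L n > \<tau>"
        using order_tendstoD(1)[OF even that] .
      then have "\<forall>\<^sub>F n in sequentially. \<tau> * ln (conv_denom (2 * n)) \<le> ln (conv_denom (Suc (2 * n)))"
        using even_eq
      proof eventually_elim
        case (elim n)
        then have "\<tau> * L n \<le> ln (conv_denom (Suc (2 * n)))"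
          by (metis less_imp_le mult_right_mono)
        then show ?case by (simp add: L_def)
      qed
      then obtain N where N: "\<And>n. n \<ge> N \<Longrightarrow> \<tau> * ln (conv_denom (2 * n)) \<le> ln (conv_denom (Suc (2 * n)))"
        by (auto simp: eventually_sequentially)
      show ?thesis
        unfolding frequently_sequentially
      proof
        fix m
        show "\<exists>k\<ge>m. \<tau> * ln (conv_denom k) \<le> ln (conv_denom (Suc k))"
          using N[of "max m N"] by (intro exI[of _ "2 * max m N"]) simp
      qed
    qed
  qed (use lam(1) in auto)
qed

section \<open>The recurrence for the logarithms\<close>

text \<open>Because 1 + u x is asymptotic to \<open>v 0\<close> times x^d, taking logarithms of the
  recursion gives a linear recurrence with middle coefficient d + 2 = lam + 1/lam and perturbation
  ln v_0 + o(1).\<close>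

lemma irrationality_exponent_eq_of_leading_coefficient:
  fixes d :: nat and lam \<nu> :: real and v :: "nat \<Rightarrow> nat \<Rightarrow> int"
  assumes d: "d \<ge> 1"
    and lam: "lam = (real d + 2 + sqrt (real d * (real d + 4))) / 2"
    and u: "\<And>n. n \<ge> 1 \<Longrightarrow> u n = (\<Sum>j=0..<d. v j n * x n ^ (d - 1 - j))"
    and v0_pos: "\<And>n. n \<ge> 1 \<Longrightarrow> v 0 n > 0"
    and \<nu>: "0 < \<nu>" "\<nu> < lam"
    and v0_growth: "(\<lambda>n. ln (real_of_int (v 0 n))) \<in> O(\<lambda>n. \<nu> ^ n)"
    and v_growth: "\<And>j. 1 \<le> j \<Longrightarrow> j \<le> d - 1 \<Longrightarrow>
      (\<lambda>n. real_of_int (v j n)) \<in> O(\<lambda>n. real_of_int (v 0 n))"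
  shows "irrationality_exponent \<alpha> = ereal lam"
proof (rule irrationality_exponent_of_growth)
  have "1 * 1 \<le> real d * (real d + 4)" using d by (intro mult_mono) auto
  then have "1 + 1 \<le> real d + sqrt (real d * (real d + 4))"
    using d by (intro add_mono real_sqrt_ge_one) auto
  then have lam2: "lam \<ge> 2" by (simp add: lam)
  have "2 * ((real d + 2 + r) / 2) - (real d + 2) = r" for r :: real by (simp add: field_simps)
  then have "2 * lam - (real d + 2) = sqrt (real d * (real d + 4))" unfolding lam .
  then have "(2 * lam - (real d + 2))\<^sup>2 = real d * (real d + 4)" by simp
  then have char: "lam * lam = (real d + 2) * lam - 1" by (simp add: power2_eq_square algebra_simps)
  have root: "lam + 1 / lam = real d + 2" using char lam2 by (simp add: field_simps)
  show "lam \<ge> 2" by fact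
  \<comment> \<open>The characteristic equation gives (lam - 1)^2 = d lam.\<close>
  have "1 * lam \<le> real d * lam" using d lam2 by (intro mult_right_mono) auto
  then have "lam \<le> (lam - 1) * (lam - 1)" using char by (simp add: algebra_simps)
  then show "lam / (lam - 1) \<le> lam - 1" using lam2 by (subst pos_divide_le_eq) auto

  \<comment> \<open>The indices are shifted so that \<open>ln (z n) = L (Suc n)\<close>, and
    \<open>w n\<close> belongs to \<open>u (Suc (Suc n))\<close>.\<close>
  define L where "L n = ln (real_of_int (x (Suc n)))" for n
  define z where "z n = real_of_int (x (Suc (Suc n)))" for n
  define v' where "v' j n = real_of_int (v j (Suc (Suc n)))" for j n
  define w where "w n = ln (1 + u (Suc (Suc n)) * z n) - d * ln (z n)" for n
  have z: "filterlim z at_top sequentially"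
    unfolding z_def by (rule filterlim_compose[OF x_at_top filterlim_Suc])
  have z1: "z n \<ge> 1" for n using x_pos[of "Suc n"] by (simp add: z_def)
  have shift: "filterlim (\<lambda>n. Suc (Suc n)) sequentially sequentially"
    by (rule filterlim_compose[OF filterlim_Suc filterlim_Suc])
  have v'0: "v' 0 n \<ge> 1" for n using v0_pos[of "Suc (Suc n)"] by (simp add: v'_def)
  have lead: "(\<lambda>n. (\<Sum>j=0..<d. v' j n * z n ^ (d - 1 - j)) / (v' 0 n * z n ^ (d - 1))) \<longlonglongrightarrow> 1"
  proof (rule sum_over_leading_term_tendsto[OF d z])
    show "v' 0 n > 0" for n using v'0[of n] by linarith
    show "(\<lambda>n. v' j n) \<in> O(\<lambda>n. v' 0 n)" if "1 \<le> j" "j \<le> d - 1" for j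
      unfolding v'_def using landau_o.big.compose[OF v_growth[OF that] shift] .
  qed
  have "(\<lambda>n. 1 / (v' 0 n * z n ^ d)) \<longlonglongrightarrow> 0"
  proof (rule tendsto_0_le[where K = 1])
    show "(\<lambda>n. 1 / z n) \<longlonglongrightarrow> 0"
      by (intro tendsto_divide_0[OF tendsto_const] filterlim_at_top_imp_at_infinity z)
    show "\<forall>\<^sub>F n in sequentially. norm (1 / (v' 0 n * z n ^ d)) \<le> norm (1 / z n) * 1"
    proof (intro always_eventually allI)
      fix n
      have "1 * z n ^ 1 \<le> v' 0 n * z n ^ d"
        using v'0[of n] z1[of n] d by (intro mult_mono power_increasing) auto
      then show "norm (1 / (v' 0 n * z n ^ d)) \<le> norm (1 / z n) * 1"
        using v'0[of n] z1[of n] by (simp add: frac_le abs_mult)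
    qed
  qed
  from tendsto_ln[OF tendsto_add[OF this lead]]
  have g: "(\<lambda>n. ln (1 / (v' 0 n * z n ^ d) + (\<Sum>j=0..<d. v' j n * z n ^ (d - 1 - j)) / (v' 0 n * z n ^ (d - 1)))) \<longlonglongrightarrow> 0"
    by (simp only: add_0 ln_one one_neq_zero not_False_eq_True)
  have w_eq: "w n = ln (v' 0 n) + ln (1 / (v' 0 n * z n ^ d) + (\<Sum>j=0..<d. v' j n * z n ^ (d - 1 - j)) / (v' 0 n * z n ^ (d - 1)))" for n
  proof -
    let ?s = "\<Sum>j=0..<d. v' j n * z n ^ (d - 1 - j)"
    have us: "real_of_int (u (Suc (Suc n))) = ?s" by (simp add: u v'_def z_def)
    have pos: "1 + ?s * z n > 0"
    proof -
      have "0 < real_of_int (u (Suc (Suc n))) * z n" using u_pos[of "Suc (Suc n)"] z1[of n] by simp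
      then show ?thesis by (simp add: us)
    qed
    have zd: "z n ^ d = z n ^ (d - 1) * z n" using d by (simp only: power_minus_mult)
    have "1 / (v' 0 n * z n ^ d) + ?s / (v' 0 n * z n ^ (d - 1)) = (1 + ?s * z n) / (v' 0 n * z n ^ d)"
      using z1[of n] v'0[of n] unfolding zd by (simp add: field_simps)
    also have "ln \<dots> = ln (1 + ?s * z n) - (ln (v' 0 n) + d * ln (z n))"
      using pos v'0[of n] z1[of n] by (simp add: ln_div ln_mult ln_realpow)
    finally show ?thesis by (simp add: w_def us)
  qed
  \<comment> \<open>Raised above 1 so that a constant error is absorbed by the powers, yet still
    below \<open>lam\<close>.\<close>
  define \<nu>' where "\<nu>' = max \<nu> ((1 + lam) / 2)"
  have \<nu>': "1 < \<nu>'" "\<nu>' < lam" "\<nu> \<le> \<nu>'" using \<nu> lam2 by (auto simp: \<nu>'_def less_max_iff_disj)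
  obtain c where c: "c > 0" "\<forall>\<^sub>F n in sequentially. norm (ln (v' 0 n)) \<le> c * norm (\<nu> ^ Suc (Suc n))"
    unfolding v'_def using landau_o.big.compose[OF v0_growth shift] by (rule landau_o.bigE)
  \<comment> \<open>The square accounts for the index shift by 2, the summand 1 for the o(1)
    term.\<close>
  define W where "W = c * \<nu>'\<^sup>2 + 1"
  have "\<forall>\<^sub>F n in sequentially. \<bar>w n\<bar> \<le> W * \<nu>' ^ n \<and> w n \<ge> - 1"
    using c(2) order_tendstoD(1)[OF g, of "-1", simplified] order_tendstoD(2)[OF g, of 1, simplified]
  proof eventually_elim
    case (elim n)
    let ?g = "ln (1 / (v' 0 n * z n ^ d) + (\<Sum>j=0..<d. v' j n * z n ^ (d - 1 - j)) / (v' 0 n * z n ^ (d - 1)))"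
    have g: "-1 < ?g" "?g < 1" using elim by auto
    \<comment> \<open>Integrality of \<open>v 0\<close> yields the lower bound -1 for
      \<open>w\<close>, which the recurrence lemma needs besides the upper bound.\<close>
    have nonneg: "ln (v' 0 n) \<ge> 0" using v'0[of n] by simp
    have "ln (v' 0 n) \<le> c * \<nu> ^ Suc (Suc n)" using elim(1) \<nu> by (simp add: abs_mult)
    also have "\<dots> \<le> c * \<nu>' ^ Suc (Suc n)" using c \<nu> \<nu>' by (intro mult_left_mono power_mono) auto
    finally have "ln (v' 0 n) \<le> c * \<nu>'\<^sup>2 * \<nu>' ^ n" by (simp add: power2_eq_square mult_ac)
    moreover have "1 \<le> \<nu>' ^ n" using \<nu>' by simp
    ultimately have "ln (v' 0 n) + 1 \<le> W * \<nu>' ^ n" by (simp add: W_def algebra_simps)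
    then show ?case using g nonneg unfolding w_eq by linarith
  qed
  then obtain N where N: "\<And>n. n \<ge> N \<Longrightarrow> \<bar>w n\<bar> \<le> W * \<nu>' ^ n" "\<And>n. n \<ge> N \<Longrightarrow> w n \<ge> - 1"
    by (auto simp: eventually_sequentially)
  have diff: "L (Suc n) - L n = ln (y (Suc n))" for n
    using x_pos[of n] y_pos[of "Suc n"] by (simp add: L_def x_Suc ln_mult)
  have "(\<lambda>n. L (Suc n) / L n) \<longlonglongrightarrow> lam"
  proof (rule perturbed_recurrence_ratio_tendsto[where X = L and lam = lam and \<nu> = \<nu>' and w = w and N = N and W = W and \<delta> = 1])
    show "L (Suc (Suc n)) = (lam + 1 / lam) * L (Suc n) - L n + w n" for n
    proof -
      have "real_of_int (u (Suc (Suc n))) * z n > 0"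
        using u_pos[of "Suc (Suc n)"] z1[of n] by simp
      then have "1 + real_of_int (u (Suc (Suc n))) * z n > 0" by linarith
      then have "ln (y (Suc (Suc n))) = ln (y (Suc n)) + ln (1 + u (Suc (Suc n)) * z n)"
        using y_pos[of "Suc n"] by (simp add: y_Suc[of "Suc n"] z_def ln_mult)
      also have "ln (1 + u (Suc (Suc n)) * z n) = w n + d * L (Suc n)" by (simp add: w_def L_def z_def)
      finally have "L (Suc (Suc n)) - L (Suc n) = (L (Suc n) - L n) + (w n + d * L (Suc n))"
        unfolding diff .
      then show ?thesis unfolding root by (simp add: algebra_simps)
    qed
    show "L n \<ge> 0" for n using x_pos[of n] by (simp add: L_def)
    show "filterlim (\<lambda>n. L (Suc n) - L n) at_top sequentially"
      unfolding diff
      by (rule filterlim_compose[OF ln_at_top filterlim_compose[OF y_at_top filterlim_Suc]])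
  qed (use N \<nu>' lam2 in auto)
  then show "(\<lambda>n. ln (x (Suc (Suc n))) / ln (x (Suc n))) \<longlonglongrightarrow> lam" by (simp add: L_def)
qed

end

section \<open>The three constructions as instances\<close>

text \<open>In each case \<open>y0 - s\<close> is m q + q' with q' the penultimate denominator.
  Adding m p to the numerator \<open>r\<close> compensates the multiple of \<open>q\<close>, so
  \<open>init\<close> is the determinant identity with sign given by the parity of the
  length.\<close>

lemma construction_signed_engel:
  assumes pq: "q \<ge> 1" "coprime p q" and m: "m \<ge> 0"
    and u_pos: "\<And>n. n \<ge> 1 \<Longrightarrow> u n > 0"
    and construction:
      "construction_E p q m u x y \<alpha> \<or> construction_P1 p q m u x y \<alpha> \<or> construction_P2 p q m u x y \<alpha>"
  obtains s t r y0 where "signed_engel s t p q r y0 u x y \<alpha>"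
  using construction
proof (elim disjE)
  assume "construction_E p q m u x y \<alpha>"
  then obtain as k where as: "length as = 2 * k + 1" "is_cf_expansion as (of_int p / of_int q)"
    "xy_recursion q (m * q + cf_denom as (2 * int k - 1) + 1) u x y"
    and \<alpha>: "\<alpha> = of_int p / of_int q + (\<Sum>j. 1 / of_int (x (j + 2)))"
    by (auto simp: construction_E_def)
  define q' where "q' = cf_denom as (2 * int k - 1)"
  \<comment> \<open>The index 2k - 1 is two less than the length 2k + 1, which the shift by 2
    restores.\<close>
  have q': "q' = cf_denom_shift as (length as)" by (simp add: q'_def cf_denom_def as nat_add_distrib nat_mult_distrib)
  obtain r where r: "p * q' - r * q = (-1) ^ length as" "q' \<ge> 0"
    "length as \<ge> 2 \<longrightarrow> q' \<ge> 1" "length as = 1 \<longrightarrow> q = 1"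
    using cf_expansion_penultimate[OF as(2) pq] unfolding q' by blast
  have "signed_engel 1 1 p q (r + m * p) (m * q + q' + 1) u x y \<alpha>"
  proof unfold_locales
    show "m * q + q' + 1 \<ge> 1" using r(2) m pq by simp
    show "q * (r + m * p) - p * (m * q + q' + 1 - 1) = 1" using r(1) as(1) by (simp add: algebra_simps)
  qed (use as(3) \<alpha> pq u_pos in \<open>auto simp: q'_def\<close>)
  then show thesis by (rule that)
next
  assume "construction_P1 p q m u x y \<alpha>"
  then obtain as k where as: "length as = 2 * k + 1" "is_cf_expansion as (of_int p / of_int q)"
    "xy_recursion q (m * q + cf_denom as (2 * int k - 1) - 1) u x y"
    and q1: "q > 1" and m1: "cf_denom as (2 * int k - 1) = 1 \<longrightarrow> m \<ge> 1"
    and \<alpha>: "\<alpha> = of_int p / of_int q + (\<Sum>j. (-1) ^ (j + 2) / of_int (x (j + 2)))"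
    by (auto simp: construction_P1_def)
  define q' where "q' = cf_denom as (2 * int k - 1)"
  have q': "q' = cf_denom_shift as (length as)" by (simp add: q'_def cf_denom_def as nat_add_distrib nat_mult_distrib)
  obtain r where r: "p * q' - r * q = (-1) ^ length as" "q' \<ge> 0"
    "length as \<ge> 2 \<longrightarrow> q' \<ge> 1" "length as = 1 \<longrightarrow> q = 1"
    using cf_expansion_penultimate[OF as(2) pq] unfolding q' by blast
  \<comment> \<open>Length 1 would force q = 1, so \<open>q > 1\<close> excludes a vanishing
    penultimate denominator.\<close>
  have "q' \<ge> 1" using r(3,4) q1 as(1) by (cases k) auto
  have y0: "m * q + q' - 1 \<ge> 1"
  proof (cases "q' = 1")
    case True
    then have "1 * 2 \<le> m * q" using m1 q1 by (intro mult_mono) (auto simp: q'_def)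
    then show ?thesis using True by simp
  next
    case False
    then show ?thesis using \<open>q' \<ge> 1\<close> mult_nonneg_nonneg[of m q] m pq by linarith
  qed
  have "signed_engel (-1) 1 p q (r + m * p) (m * q + q' - 1) u x y \<alpha>"
  proof unfold_locales
    show "q * (r + m * p) - p * (m * q + q' - 1 - (- 1)) = 1" using r(1) as(1) by (simp add: algebra_simps)
  qed (use as(3) \<alpha> pq u_pos y0 in \<open>auto simp: q'_def\<close>)
  then show thesis by (rule that)
next
  assume "construction_P2 p q m u x y \<alpha>"
  then obtain as k where as: "length as = 2 * k + 2" "is_cf_expansion as (of_int p / of_int q)"
    "xy_recursion q (m * q + cf_denom as (2 * int k) - 1) u x y"
    and q1: "q > 1" and m1: "cf_denom as (2 * int k) = 1 \<longrightarrow> m \<ge> 1"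
    and \<alpha>: "\<alpha> = of_int p / of_int q - (\<Sum>j. (-1) ^ (j + 2) / of_int (x (j + 2)))"
    by (auto simp: construction_P2_def)
  define q' where "q' = cf_denom as (2 * int k)"
  have q': "q' = cf_denom_shift as (length as)" by (simp add: q'_def cf_denom_def as nat_add_distrib nat_mult_distrib)
  obtain r where r: "p * q' - r * q = (-1) ^ length as" "q' \<ge> 0"
    "length as \<ge> 2 \<longrightarrow> q' \<ge> 1" "length as = 1 \<longrightarrow> q = 1"
    using cf_expansion_penultimate[OF as(2) pq] unfolding q' by blast
  have "q' \<ge> 1" using r(3) as(1) by auto
  have y0: "m * q + q' - 1 \<ge> 1"
  proof (cases "q' = 1")
    case True
    then have "1 * 2 \<le> m * q" using m1 q1 by (intro mult_mono) (auto simp: q'_def)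
    then show ?thesis using True by simp
  next
    case False
    then show ?thesis using \<open>q' \<ge> 1\<close> mult_nonneg_nonneg[of m q] m pq by linarith
  qed
  have "signed_engel (-1) (-1) p q (r + m * p) (m * q + q' - 1) u x y \<alpha>"
  proof unfold_locales
    show "q * (r + m * p) - p * (m * q + q' - 1 - (- 1)) = -1" using r(1) as(1) by (simp add: algebra_simps)
  qed (use as(3) \<alpha> pq u_pos y0 in \<open>auto simp: q'_def\<close>)
  then show thesis by (rule that)
qed

theorem theorem3p3:
  fixes d :: nat and lam \<nu> \<alpha> :: real and p q m :: int
    and u x y :: "nat \<Rightarrow> int" and v :: "nat \<Rightarrow> nat \<Rightarrow> int"
  assumes d: "d \<ge> 1"
    and lam: "lam = (real d + 2 + sqrt (real d * (real d + 4))) / 2"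
    and pq: "q \<ge> 1" "coprime p q"
    and m: "m \<ge> 0"
    and u_pos: "\<And>n. n \<ge> 1 \<Longrightarrow> u n > 0"
    and construction:
      "construction_E p q m u x y \<alpha> \<or> construction_P1 p q m u x y \<alpha> \<or> construction_P2 p q m u x y \<alpha>"
    and u: "\<And>n. n \<ge> 1 \<Longrightarrow> u n = (\<Sum>j=0..<d. v j n * x n ^ (d - 1 - j))"
    and v0_pos: "\<And>n. n \<ge> 1 \<Longrightarrow> v 0 n > 0"
    and \<nu>: "0 < \<nu>" "\<nu> < lam"
    and v0_growth: "(\<lambda>n. ln (real_of_int (v 0 n))) \<in> O(\<lambda>n. \<nu> ^ n)"
    and v_growth: "\<And>j. 1 \<le> j \<Longrightarrow> j \<le> d - 1 \<Longrightarrow>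
      (\<lambda>n. real_of_int (v j n)) \<in> O(\<lambda>n. real_of_int (v 0 n))"
  shows "irrationality_exponent \<alpha> = ereal lam"
proof -
  obtain s t r y0 where "signed_engel s t p q r y0 u x y \<alpha>"
    using construction_signed_engel[OF pq m u_pos construction] .
  then show ?thesis
    by (rule signed_engel.irrationality_exponent_eq_of_leading_coefficient[OF _ d lam u v0_pos \<nu> v0_growth v_growth])
qed

end
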